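(* Let $\tau:\mathbb{Z}/2\mathbb{Z}\to\mathcal{C}_s$ be a faithful representation, where $\mathcal{C}_s\subset O(\mathbb{R}^2)$ is the group of order $2$ generated by a reflection, let $(H,\psi)$ be a finite $\mathbb{Z}/2\mathbb{Z}$-gain graph, and let $\tilde p:V(H)\to\mathbb{R}^2$ be $\mathcal{C}_s$-regular. Then $O_1(H,\psi,\tilde p)$ is row independent if and only if $(H,\psi)$ is $(2,3,2)$-gain-sparse.
   Context: A $\Gamma$-gain graph $(H,\psi)$ is a directed multigraph $H$ (loops and parallel edges allowed) with a map $\psi:E(H)\to\Gamma$; the orientation is only a reference, reversing an edge inverts its gain. Here $\Gamma=\mathbb{Z}/2\mathbb{Z}$. Gain-sparsity: a cycle (a loop is a cycle, two parallel edges form a cycle) is balanced if the product of its edge gains along the cycle (inverted for edges traversed backwards) is the identity. $F\subseteq E(H)$ is balanced if all cycles in $F$ are balanced. $V(F)$ is the set of endpoints of edges in $F$. $(H,\psi)$ is $(k,\ell,m)$-gain-sparse if $|F|\le k|V(F)|-\ell$ for every nonempty balanced $F\subseteq E(H)$ and $|F|\le k|V(F)|-m$ for every nonempty $F\subseteq E(H)$. Orbit rigidity matrix $O_1(H,\psi,\tilde p)$: the $|E(H)|\times 2|V(H)|$ matrix whose row for $\tilde e=(\tilde u,\tilde v)$ has $(\tilde p(\tilde u)-\tau(\psi(\tilde e))\tilde p(\tilde v))^\top$ in the two columns of $\tilde u$, $(-1)^{\psi(\tilde e)}(\tilde p(\tilde v)-\tau(\psi(\tilde e))^{-1}\tilde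 p(\tilde u))^\top$ in the two columns of $\tilde v$, and $0$ elsewhere; for a loop at $\tilde v$ the entries in the columns of $\tilde v$ are the sum of these two vectors. Row independent means the rows are linearly independent. Regularity: the covering graph $G$ of $(H,\psi)$ has vertex set $\Gamma\times V(H)$ (write $gv$ for $(g,v)$) and edges $\{g\tilde u,g\psi(\tilde e)\tilde v\}$ for $\tilde e=(\tilde u,\tilde v)\in E(H)$, $g\in\Gamma$. A map $\tilde p:V(H)\to\mathbb{R}^2$ determines $p:V(G)\to\mathbb{R}^2$ by $p(g\tilde v)=\tau(g)\tilde p(\tilde v)$. The rigidity matrix $R(G,p)$ has, for each edge $\{u,v\}$ of $G$, a row with $(p(u)-p(v))^\top$ in the columns of $u$, $(p(v)-p(u))^\top$ in the columns of $v$, and $0$ elsewhere (degenerate edges with both ends equal contribute a zero row). $\tilde p$ is $\mathcal{C}_s$-regular if $\operatorname{rank}R(G,p)$ is maximal among all maps $p$ arising in this way from maps $V(H)\to\mathbb{R}^2$. *)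

theory Defs
  imports
    "HOL-Analysis.Analysis"
    "HOL-Library.Z2"
    "Graph_Theory.Arc_Walk"
begin

text \<open>
  The group \<open>\<int>/2\<int>\<close> is the additive group of the type \<^typ>\<open>bit\<close>. Gain groups are written
  additively, with \<^class>\<open>group_add\<close>, so that commutativity is not built in: the product
  of gains along a cycle is a sum and the identity is \<open>0\<close>.
\<close>

instance bit :: finite
proof
  have "(UNIV :: bit set) = {0, 1}"
    by (auto intro: bit.exhaust)
  then show "finite (UNIV :: bit set)"
    by (metis finite.emptyI finite.insertI)
qed


section \<open>Gain graphs and gain sparsity\<close>

text \<open>
  Every edge \<open>e\<close> of \<open>H\<close> can be traversed in two ways: \<open>(e, True)\<close> is the traversal along the
  reference orientation, \<open>(e, False)\<close> the one against it. Undirected walks in \<open>H\<close> are the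
  directed walks of the following graph.
\<close>

definition traversals :: "('v, 'e) pre_digraph \<Rightarrow> ('v, 'e \<times> bool) pre_digraph" where
  "traversals H =
     \<lparr> verts = verts H,
       arcs = arcs H \<times> UNIV,
       tail = (\<lambda>(e, d). if d then tail H e else head H e),
       head = (\<lambda>(e, d). if d then head H e else tail H e) \<rparr>"

text \<open>
  Distinctness of the edges only excludes going back and forth along a single edge. A loop
  (in either direction) and a pair of parallel edges do count as cycles.
\<close>

definition gain_cycle :: "('v, 'e) pre_digraph \<Rightarrow> ('e \<times> bool) list \<Rightarrow> bool" where
  "gain_cycle H c \<longleftrightarrow> pre_digraph.cycle (traversals H) c \<and> distinct (map fst c)"

definition cycle_gain :: "('e \<Rightarrow> 'g::group_add) \<Rightarrow> ('e \<times> bool) list \<Rightarrow> 'g" where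
  "cycle_gain \<psi> c = sum_list (map (\<lambda>(e, d). if d then \<psi> e else - \<psi> e) c)"

definition balanced :: "('v, 'e) pre_digraph \<Rightarrow> ('e \<Rightarrow> 'g::group_add) \<Rightarrow> 'e set \<Rightarrow> bool" where
  "balanced H \<psi> F \<longleftrightarrow> (\<forall>c. gain_cycle H c \<and> fst ` set c \<subseteq> F \<longrightarrow> cycle_gain \<psi> c = 0)"

definition endpoints :: "('v, 'e) pre_digraph \<Rightarrow> 'e set \<Rightarrow> 'v set" where
  "endpoints H F = tail H ` F \<union> head H ` F"

definition gain_sparse ::
  "nat \<Rightarrow> nat \<Rightarrow> nat \<Rightarrow> ('v, 'e) pre_digraph \<Rightarrow> ('e \<Rightarrow> 'g::group_add) \<Rightarrow> bool" where
  "gain_sparse k l m H \<psi> \<longleftrightarrow>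
     (\<forall>F. F \<subseteq> arcs H \<and> F \<noteq> {} \<and> balanced H \<psi> F \<longrightarrow>
        int (card F) \<le> int k * int (card (endpoints H F)) - int l) \<and>
     (\<forall>F. F \<subseteq> arcs H \<and> F \<noteq> {} \<longrightarrow>
        int (card F) \<le> int k * int (card (endpoints H F)) - int m)"


section \<open>Reflection groups in the plane\<close>

text \<open>The reflection of the plane in the line through the origin orthogonal to \<open>n \<noteq> 0\<close>.\<close>

definition reflection_matrix :: "real^2 \<Rightarrow> real^2^2" where
  "reflection_matrix n = matrix (\<lambda>x. x - (2 * (x \<bullet> n) / (n \<bullet> n)) *\<^sub>R n)"

definition is_Cs :: "(real^2^2) set \<Rightarrow> bool" where
  "is_Cs C \<longleftrightarrow> (\<exists>n. n \<noteq> 0 \<and> C = {mat 1, reflection_matrix n})"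

definition faithful_representation :: "(real^2^2) set \<Rightarrow> ('g::group_add \<Rightarrow> real^2^2) \<Rightarrow> bool" where
  "faithful_representation C \<tau> \<longleftrightarrow>
     range \<tau> \<subseteq> C \<and> (\<forall>g h. \<tau> (g + h) = \<tau> g ** \<tau> h) \<and> inj \<tau>"


section \<open>Covering graph, rigidity matrix and regularity\<close>

definition covering_edges ::
  "('v, 'e) pre_digraph \<Rightarrow> ('e \<Rightarrow> 'g::group_add) \<Rightarrow> ('g \<times> 'v) set set" where
  "covering_edges H \<psi> = {{(g, tail H e), (g + \<psi> e, head H e)} | g e. e \<in> arcs H}"

definition covering_placement ::
  "('g \<Rightarrow> real^2^2) \<Rightarrow> ('v \<Rightarrow> real^2) \<Rightarrow> 'g \<times> 'v \<Rightarrow> real^2" where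
  "covering_placement \<tau> p = (\<lambda>(g, v). \<tau> g *v p v)"

text \<open>
  A row of a matrix whose columns come in pairs, one pair for every vertex, is a vector in
  \<open>(real^2)^'a\<close>. The matrices below are given by the families of their rows. If the vertex
  set of the graph is a proper subset of the finite type \<open>'a\<close>, the entries at the other
  elements of \<open>'a\<close> are \<open>0\<close>.
\<close>

definition rigidity_row :: "('a::finite \<Rightarrow> real^2) \<Rightarrow> 'a \<Rightarrow> 'a \<Rightarrow> (real^2)^'a" where
  "rigidity_row p u v =
     (\<chi> w. if w = u then p u - p v else if w = v then p v - p u else 0)"

text \<open>
  The rank of the rigidity matrix, as the dimension of the span of its rows (compare
  \<open>row_rank_def\<close>). The row of an edge \<open>{u, v}\<close> does not depend on the order of \<open>u\<close> and \<open>v\<close>,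
  and it is \<open>0\<close> if \<open>u = v\<close>.
\<close>

definition rigidity_rank :: "'a::finite set set \<Rightarrow> ('a \<Rightarrow> real^2) \<Rightarrow> nat" where
  "rigidity_rank E p = dim {rigidity_row p u v | u v. {u, v} \<in> E}"

definition regular_placement ::
  "('g::{finite, group_add} \<Rightarrow> real^2^2) \<Rightarrow> ('v::finite, 'e) pre_digraph \<Rightarrow> ('e \<Rightarrow> 'g)
     \<Rightarrow> ('v \<Rightarrow> real^2) \<Rightarrow> bool" where
  "regular_placement \<tau> H \<psi> p \<longleftrightarrow>
     (\<forall>q. rigidity_rank (covering_edges H \<psi>) (covering_placement \<tau> q)
            \<le> rigidity_rank (covering_edges H \<psi>) (covering_placement \<tau> p))"


section \<open>The orbit rigidity matrix\<close>

text \<open>The factor \<open>(-1)^g\<close> for \<open>g\<close> in \<open>\<int>/2\<int>\<close>.\<close>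

definition bit_sign :: "bit \<Rightarrow> real" where
  "bit_sign g = (if g = 0 then 1 else - 1)"

text \<open>For a loop, both summands contribute to the columns of its vertex.\<close>

definition orbit_row ::
  "(bit \<Rightarrow> real^2^2) \<Rightarrow> ('v::finite, 'e) pre_digraph \<Rightarrow> ('e \<Rightarrow> bit) \<Rightarrow> ('v \<Rightarrow> real^2)
     \<Rightarrow> 'e \<Rightarrow> (real^2)^'v" where
  "orbit_row \<tau> H \<psi> p e =
     (\<chi> w. (if w = tail H e then p (tail H e) - \<tau> (\<psi> e) *v p (head H e) else 0)
         + (if w = head H e
            then bit_sign (\<psi> e) *\<^sub>R (p (head H e) - matrix_inv (\<tau> (\<psi> e)) *v p (tail H e))
            else 0))"

text \<open>
  Linear independence of the rows as a family indexed by the edges: by injectivity, two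
  different edges must not have equal rows.
\<close>

definition orbit_row_independent ::
  "(bit \<Rightarrow> real^2^2) \<Rightarrow> ('v::finite, 'e) pre_digraph \<Rightarrow> ('e \<Rightarrow> bit) \<Rightarrow> ('v \<Rightarrow> real^2) \<Rightarrow> bool" where
  "orbit_row_independent \<tau> H \<psi> p \<longleftrightarrow>
     inj_on (orbit_row \<tau> H \<psi> p) (arcs H) \<and> independent (orbit_row \<tau> H \<psi> p ` arcs H)"

end

theory Submission
  imports Defs
begin

text \<open>
  Balance of \<open>F\<close> means that the gains on \<open>F\<close> come from a potential \<open>\<theta>\<close>. Every row of \<open>O_1\<close> is
  annihilated by the infinitesimal rotations and by the translations along the normal \<open>n\<close> of the
  mirror; on a balanced set \<open>F\<close> the potential turns all translations into such motions. These 2,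
  respectively 3, dimensions give the necessity of the sparsity conditions.

  For sufficiency, Henneberg's construction yields one placement with independent rows. A sparse
  gain graph has a vertex \<open>v\<close> of degree at most 3. If the degree is 3, then \<open>v\<close> can be replaced by an
  edge between two of its neighbours: otherwise tight sets block all these edges, and their
  union leaves no room for the three edges at \<open>v\<close>. Conversely, \<open>v\<close> is put in the middle of this
  edge, after a generic perturbation of the other points.

  Independence carries over to regular placements because \<open>R(G, p)\<close> splits into the orbit matrices
  \<open>O_0\<close> and \<open>O_1\<close>, so that its rank is the sum of theirs, and both attain their maximal ranks at almost
  all points of a line of placements: a pencil \<open>a + t b\<close> of vectors that is independent for one \<open>t\<close> is
  independent for all but finitely many \<open>t\<close>.
\<close>

section \<open>Pencils of vectors\<close>

lemma inj_on_independent_image_iff: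
  fixes f :: "'e \<Rightarrow> 'a::real_vector"
  assumes "finite E"
  shows "inj_on f E \<and> independent (f ` E) \<longleftrightarrow>
    (\<forall>c. (\<Sum>e\<in>E. c e *\<^sub>R f e) = 0 \<longrightarrow> (\<forall>e\<in>E. c e = 0))" (is "?L \<longleftrightarrow> ?R")
proof
  assume L: ?L
  show ?R
  proof (intro allI impI)
    fix c assume s: "(\<Sum>e\<in>E. c e *\<^sub>R f e) = 0"
    let ?g = "inv_into E f"
    have "(\<Sum>x\<in>f ` E. c (?g x) *\<^sub>R x) = (\<Sum>e\<in>E. c e *\<^sub>R f e)"
      using L by (subst sum.reindex) (auto intro!: sum.cong)
    then have "\<forall>x\<in>f ` E. c (?g x) = 0"
      using L s assms independentD[of "f ` E" "f ` E" "c \<circ> ?g"] by (auto simp: o_def)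
    then show "\<forall>e\<in>E. c e = 0" using L by auto
  qed
next
  assume R: ?R
  have inj: "inj_on f E"
  proof (rule inj_onI, rule ccontr)
    fix x y assume xy: "x \<in> E" "y \<in> E" "f x = f y" "x \<noteq> y"
    let ?c = "\<lambda>e. (if e = x then 1 else 0) - (if e = y then 1 else (0::real))"
    have "(\<Sum>e\<in>E. ?c e *\<^sub>R f e) = 0"
      using xy assms by (simp add: scaleR_left_diff_distrib sum_subtractf if_distrib[of "\<lambda>c. c *\<^sub>R _"] cong: if_cong)
    then have "?c x = 0" using R[rule_format, of ?c x] xy by blast
    then show False using xy by simp
  qed
  moreover have "independent (f ` E)"
  proof (rule independent_if_scalars_zero)
    fix c x assume s: "(\<Sum>x\<in>f ` E. c x *\<^sub>R x) = 0" "x \<in> f ` E"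
    then show "c x = 0"
      using R[rule_format, of "c \<circ> f"] inj by (auto simp: sum.reindex)
  qed (use assms in simp)
  ultimately show ?L by simp
qed

text \<open>Applying \<open>L\<close> to a relation and subtracting \<open>m\<close> times the
  relation eliminates \<open>w m\<close>; the induction hypothesis then applies to the coefficients
  \<open>(l - m) * c l\<close>.\<close>

lemma linear_eigenvectors_independent:
  fixes L :: "'a::real_vector \<Rightarrow> 'a"
  assumes L: "linear L" and fin: "finite S"
    and eig: "\<And>l. l \<in> S \<Longrightarrow> L (w l) = l *\<^sub>R w l" and nz: "\<And>l. l \<in> S \<Longrightarrow> w l \<noteq> 0"
    and sum0: "(\<Sum>l\<in>S. c l *\<^sub>R w l) = 0"
  shows "\<forall>l\<in>S. c l = 0"
  using fin eig nz sum0
proof (induction S arbitrary: c rule: finite_induct)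
  case (insert m S)
  interpret linear L by (rule L)
  have s: "c m *\<^sub>R w m + (\<Sum>l\<in>S. c l *\<^sub>R w l) = 0" using insert by simp
  then have "L (c m *\<^sub>R w m + (\<Sum>l\<in>S. c l *\<^sub>R w l)) = 0" by simp
  then have "(m * c m) *\<^sub>R w m + (\<Sum>l\<in>S. (l * c l) *\<^sub>R w l) = 0"
    using insert.prems(1) by (simp add: add sum scale mult.commute)
  moreover have "(m * c m) *\<^sub>R w m + (\<Sum>l\<in>S. (m * c l) *\<^sub>R w l) = 0"
    using arg_cong[OF s, of "\<lambda>x. m *\<^sub>R x"] by (simp add: scaleR_add_right scaleR_sum_right)
  ultimately have "(\<Sum>l\<in>S. (l * c l) *\<^sub>R w l) - (\<Sum>l\<in>S. (m * c l) *\<^sub>R w l) = 0"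
    by (metis add_left_imp_eq cancel_comm_monoid_add_class.diff_cancel)
  then have "(\<Sum>l\<in>S. ((l - m) * c l) *\<^sub>R w l) = 0"
    by (simp add: sum_subtractf[symmetric] left_diff_distrib scaleR_left_diff_distrib)
  then have "\<forall>l\<in>S. (l - m) * c l = 0"
    using insert.prems by (intro insert.IH) auto
  then have S0: "\<forall>l\<in>S. c l = 0" using insert.hyps by auto
  then have "c m *\<^sub>R w m = 0" using s by simp
  then show ?case using S0 insert.prems(2)[of m] by simp
qed simp

text \<open>More distinct eigenvalues than the dimension would yield too many independent
  eigenvectors.\<close>

lemma finite_real_eigenvalues:
  fixes L :: "'a::euclidean_space \<Rightarrow> 'a"
  assumes L: "linear L"
  shows "finite {l. \<exists>w. w \<noteq> 0 \<and> L w = l *\<^sub>R w}"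
proof (rule ccontr)
  assume "infinite {l. \<exists>w. w \<noteq> 0 \<and> L w = l *\<^sub>R w}"
  then obtain S where S: "finite S" "card S = Suc DIM('a)" "S \<subseteq> {l. \<exists>w. w \<noteq> 0 \<and> L w = l *\<^sub>R w}"
    by (meson infinite_arbitrarily_large)
  then have "\<forall>l\<in>S. \<exists>w. w \<noteq> 0 \<and> L w = l *\<^sub>R w" by auto
  then obtain w where w: "\<And>l. l \<in> S \<Longrightarrow> w l \<noteq> 0 \<and> L (w l) = l *\<^sub>R w l"
    by metis
  then have "inj_on w S \<and> independent (w ` S)"
    unfolding inj_on_independent_image_iff[OF S(1)]
    using linear_eigenvectors_independent[OF L S(1), of w] by blast
  then show False
    using independent_bound[of "w ` S"] S(2) by (simp add: card_image)
qed

text \<open>As the vectors \<open>a e\<close> are independent, some linear \<open>L\<close> sends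
  each \<open>a e\<close> to \<open>b e\<close>. A dependency at \<open>t\<close> gives
  \<open>w \<noteq> 0\<close> with \<open>w + t *\<^sub>R L w = 0\<close>, so
  \<open>- inverse t\<close> is an eigenvalue of \<open>L\<close>, and there are only finitely many
  of these.\<close>

lemma finite_dependent_pencil:
  fixes a b :: "'e \<Rightarrow> 'a::euclidean_space"
  assumes "finite E" and "inj_on a E" "independent (a ` E)"
  shows "finite {t. \<not> (inj_on (\<lambda>e. a e + t *\<^sub>R b e) E \<and> independent ((\<lambda>e. a e + t *\<^sub>R b e) ` E))}"
    (is "finite ?B")
proof -
  obtain L where L: "linear L" "\<forall>x\<in>a ` E. L x = (b \<circ> inv_into E a) x"
    using linear_independent_extend[OF assms(3)] by blast
  interpret linear L by (rule L)
  have La: "L (a e) = b e" if "e \<in> E" for e using L(2) that assms by simp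
  have ind: "c e = 0" if "(\<Sum>e\<in>E. c e *\<^sub>R a e) = 0" "e \<in> E" for c e
    using assms(2,3) inj_on_independent_image_iff[OF assms(1), of a] that by blast
  have "\<exists>l\<in>{l. \<exists>w. w \<noteq> 0 \<and> L w = l *\<^sub>R w}. t = - inverse l" if "t \<in> ?B" for t
  proof -
    have "\<not> (\<forall>c. (\<Sum>e\<in>E. c e *\<^sub>R (a e + t *\<^sub>R b e)) = 0 \<longrightarrow> (\<forall>e\<in>E. c e = 0))"
      using that unfolding mem_Collect_eq inj_on_independent_image_iff[OF assms(1)] .
    then obtain c e where c: "(\<Sum>e\<in>E. c e *\<^sub>R (a e + t *\<^sub>R b e)) = 0" "e \<in> E" "c e \<noteq> 0"
      by auto
    let ?w = "\<Sum>e\<in>E. c e *\<^sub>R a e"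
    have "L ?w = (\<Sum>e\<in>E. c e *\<^sub>R b e)" by (simp add: sum scale La)
    then have eq: "?w + t *\<^sub>R L ?w = 0"
      using c(1) by (simp add: scaleR_add_right sum.distrib scaleR_sum_right mult.commute)
    have w0: "?w \<noteq> 0" using ind c by blast
    then have "t \<noteq> 0" using eq by auto
    have "t *\<^sub>R L ?w = - ?w" using eq by (simp add: add_eq_0_iff)
    then have "inverse t *\<^sub>R t *\<^sub>R L ?w = inverse t *\<^sub>R (- ?w)" by simp
    then have "L ?w = (- inverse t) *\<^sub>R ?w" using \<open>t \<noteq> 0\<close> by simp
    then show ?thesis using w0 by (intro bexI[of _ "- inverse t"]) auto
  qed
  then have "?B \<subseteq> (\<lambda>l. - inverse l) ` {l. \<exists>w. w \<noteq> 0 \<and> L w = l *\<^sub>R w}" by blast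
  then show ?thesis
    using finite_real_eigenvalues[OF L(1)] finite_surj by blast
qed

section \<open>Sparse sets of gain edges\<close>

lemma bit_add_self [simp]: "(x::bit) + x = 0" "x + (x + y) = y"
  by (cases x; cases y; simp)+

declare add_bit_eq_xor [simp del]

text \<open>An edge is identified with its tail, head and gain, so that sets of edges suffice.
  Sparsity excludes parallel edges with the same data, since they would form a balanced cycle on two
  vertices.\<close>

type_synonym 'v gain_edge = "'v \<times> 'v \<times> bit"

definition edge_verts :: "'v gain_edge set \<Rightarrow> 'v set" where
  "edge_verts F = (\<Union>(u, v, g)\<in>F. {u, v})"

definition potential :: "('v \<Rightarrow> bit) \<Rightarrow> 'v gain_edge set \<Rightarrow> bool" where
  "potential \<theta> F \<longleftrightarrow> (\<forall>(u, v, g)\<in>F. g = \<theta> u + \<theta> v)"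

definition sparse :: "'v gain_edge set \<Rightarrow> bool" where
  "sparse E \<longleftrightarrow> (\<forall>F. F \<subseteq> E \<and> F \<noteq> {} \<longrightarrow>
     card F + 2 \<le> 2 * card (edge_verts F) \<and>
     ((\<exists>\<theta>. potential \<theta> F) \<longrightarrow> card F + 3 \<le> 2 * card (edge_verts F)))"

lemma edge_verts_simps [simp]:
  "edge_verts {} = {}"
  "edge_verts (insert (u, v, g) F) = insert u (insert v (edge_verts F))"
  "edge_verts (F \<union> F') = edge_verts F \<union> edge_verts F'"
  by (auto simp: edge_verts_def)

lemma edge_verts_mono: "F \<subseteq> F' \<Longrightarrow> edge_verts F \<subseteq> edge_verts F'"
  by (auto simp: edge_verts_def)

lemma edge_vertsI:
  "(u, v, g) \<in> F \<Longrightarrow> u \<in> edge_verts F" "(u, v, g) \<in> F \<Longrightarrow> v \<in> edge_verts F"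
  by (force simp: edge_verts_def)+

lemma edge_verts_nonempty: "F \<noteq> {} \<Longrightarrow> edge_verts F \<noteq> {}"
  using edge_vertsI by fastforce

lemma potential_simps [simp]:
  "potential \<theta> {}"
  "potential \<theta> (insert (u, v, g) F) \<longleftrightarrow> g = \<theta> u + \<theta> v \<and> potential \<theta> F"
  "potential \<theta> (F \<union> F') \<longleftrightarrow> potential \<theta> F \<and> potential \<theta> F'"
  by (simp_all add: potential_def ball_Un)

lemma edge_verts_UN: "edge_verts F = (\<Union>e\<in>F. edge_verts {e})"
  by (simp add: edge_verts_def)

lemma potential_Ball: "potential \<theta> F \<longleftrightarrow> (\<forall>e\<in>F. potential \<theta> {e})"
  by (simp add: potential_def)

lemma potential_mono: "potential \<theta> F' \<Longrightarrow> F \<subseteq> F' \<Longrightarrow> potential \<theta> F"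
  by (auto simp: potential_def)

lemma potential_cong:
  assumes "potential \<theta> F" "edge_verts F \<subseteq> X" "\<forall>x\<in>X. \<theta>' x = \<theta> x"
  shows "potential \<theta>' F"
  unfolding potential_def
proof clarify
  fix u v g assume e: "(u, v, g) \<in> F"
  then have "u \<in> X" "v \<in> X" using assms(2) edge_vertsI[OF e] by auto
  then show "g = \<theta>' u + \<theta>' v" using e assms(1,3) by (auto simp: potential_def)
qed

lemma potential_shift: "potential \<theta> F \<Longrightarrow> potential (\<lambda>x. \<theta> x + k) F"
  by (auto simp: potential_def)

lemma sparse_mono: "sparse E \<Longrightarrow> E' \<subseteq> E \<Longrightarrow> sparse E'"
  unfolding sparse_def by blast

lemma edge_verts_Int: "edge_verts F \<subseteq> X \<Longrightarrow> edge_verts F' \<subseteq> X' \<Longrightarrow> edge_verts (F \<inter> F') \<subseteq> X \<inter> X'"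
  by (force simp: edge_verts_def)

lemma Int_eq_singletonI:
  fixes X Y :: "'v::finite set"
  assumes "\<not> 2 \<le> card (X \<inter> Y)" "x \<in> X" "x \<in> Y"
  shows "X \<inter> Y = {x}"
proof -
  have "card (X \<inter> Y) \<le> card {x}" "{x} \<subseteq> X \<inter> Y" using assms by auto
  then show ?thesis using card_seteq[OF finite, of "{x}" "X \<inter> Y"] by blast
qed

section \<open>Counting bounds in sparse sets\<close>

context
  fixes E :: "'v::finite gain_edge set"
  assumes sparse: "sparse E"
begin

lemma sparse_card_le:
  assumes "F \<subseteq> E" "edge_verts F \<subseteq> X" "X \<noteq> {}"
  shows "card F + 2 \<le> 2 * card X"
proof (cases "F = {}")
  case True
  have "card X \<ge> 1" using assms(3) by (simp add: Suc_leI card_gt_0_iff)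
  with True show ?thesis by simp
next
  case False
  then have "card F + 2 \<le> 2 * card (edge_verts F)" using assms sparse by (simp add: sparse_def)
  also have "\<dots> \<le> 2 * card X" using assms(2) by (simp add: card_mono)
  finally show ?thesis .
qed

text \<open>Two vertices are required because of the empty set of edges on a single vertex, for
  which the bound fails.\<close>

lemma sparse_card_le_balanced:
  assumes "F \<subseteq> E" "edge_verts F \<subseteq> X" "2 \<le> card X" "potential \<theta> F"
  shows "card F + 3 \<le> 2 * card X"
proof (cases "F = {}")
  case False
  then have "card F + 3 \<le> 2 * card (edge_verts F)" using assms sparse by (auto simp: sparse_def)
  also have "\<dots> \<le> 2 * card X" using assms(2) by (simp add: card_mono)
  finally show ?thesis .
qed (use assms in simp)

text \<open>No edge of \<open>F\<close> joins the two level sets of \<open>\<delta>\<close>, and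
  both meet \<open>X\<close>. The bound with 2 applies to each of them, which gives 4 in
  total.\<close>

lemma sparse_card_le_disconnected:
  fixes \<delta> :: "'v \<Rightarrow> bit"
  assumes "F \<subseteq> E" "edge_verts F \<subseteq> X" "x \<in> X" "y \<in> X" "\<delta> x \<noteq> \<delta> y"
    and \<delta>: "\<And>u v g. (u, v, g) \<in> F \<Longrightarrow> \<delta> u = \<delta> v"
  shows "card F + 4 \<le> 2 * card X"
proof -
  define F' where "F' i = {e \<in> F. \<delta> (fst e) = i}" for i
  define X' where "X' i = {x \<in> X. \<delta> x = i}" for i
  have "F' 0 \<union> F' 1 = F" "F' 0 \<inter> F' 1 = {}" by (auto simp: F'_def) 
  then have cF: "card F = card (F' 0) + card (F' 1)" by (metis card_Un_disjoint finite)
  have "X' 0 \<union> X' 1 = X" "X' 0 \<inter> X' 1 = {}" by (auto simp: X'_def) 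
  then have cX: "card X = card (X' 0) + card (X' 1)" by (metis card_Un_disjoint finite)
  have "card (F' i) + 2 \<le> 2 * card (X' i)" for i
  proof (rule sparse_card_le)
    show "edge_verts (F' i) \<subseteq> X' i"
      using assms(2) \<delta> by (fastforce simp: edge_verts_def F'_def X'_def)
    show "X' i \<noteq> {}"
      using assms(3-5) by (cases i; cases "\<delta> x") (auto simp: X'_def)
  qed (use assms in \<open>auto simp: F'_def\<close>)
  from this[of 0] this[of 1] show ?thesis using cF cX by simp
qed

text \<open>A loop violates the bound for arbitrary sets. Modulo 2 a reversed edge keeps its gain,
  so an edge and its reversal would form a balanced cycle.\<close>

lemma sparse_edge_simple:
  assumes "(x, y, g) \<in> E"
  shows "x \<noteq> y" "(y, x, g) \<notin> E"
proof -
  show *: "x \<noteq> y"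
    using sparse_card_le[of "{(x, y, g)}" "{x, y}"] assms by auto
  show "(y, x, g) \<notin> E"
  proof
    assume "(y, x, g) \<in> E"
    then have "card {(x, y, g), (y, x, g)} + 3 \<le> 2 * card {x, y}"
      using * assms by (intro sparse_card_le_balanced[of _ _ "\<lambda>w. if w = x then g else 0"]) auto
    then show False using * by simp
  qed
qed

section \<open>Tight sets and their unions\<close>

definition unbal_tight :: "'v set \<Rightarrow> 'v gain_edge set \<Rightarrow> bool" where
  "unbal_tight X F \<longleftrightarrow> F \<subseteq> E \<and> edge_verts F \<subseteq> X \<and> 2 * card X \<le> card F + 2"

text \<open>In both notions of tightness the sparsity bound turns the inequality into an equality,
  except for the smallest sets \<open>X\<close>. Keeping \<open>X\<close> apart from
  \<open>F\<close> allows isolated vertices, which can arise when two tight sets are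
  intersected.\<close>

definition bal_tight :: "'v set \<Rightarrow> 'v gain_edge set \<Rightarrow> ('v \<Rightarrow> bit) \<Rightarrow> bool" where
  "bal_tight X F \<theta> \<longleftrightarrow> F \<subseteq> E \<and> edge_verts F \<subseteq> X \<and> potential \<theta> F \<and> 2 * card X \<le> card F + 3"

text \<open>Cardinality is modular under union and intersection, for edges as well as for vertices,
  so the sparsity bound on the intersection forces the union to be tight.\<close>

lemma unbal_unbal_Un:
  assumes "unbal_tight X1 F1" "unbal_tight X2 F2" "x \<in> X1" "x \<in> X2"
  shows "unbal_tight (X1 \<union> X2) (F1 \<union> F2)"
proof -
  have "card (F1 \<inter> F2) + 2 \<le> 2 * card (X1 \<inter> X2)"
    using assms edge_verts_Int[of F1 X1 F2 X2] by (intro sparse_card_le) (auto simp: unbal_tight_def)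
  then show ?thesis
    using assms card_Un_Int[of F1 F2] card_Un_Int[of X1 X2] by (auto simp: unbal_tight_def)
qed

text \<open>The intersection inherits the potential of \<open>F2\<close>; its bound with 3 makes up
  for the weaker tightness of the balanced set.\<close>

lemma unbal_bal_Un:
  assumes "unbal_tight X1 F1" "bal_tight X2 F2 \<theta>" "2 \<le> card (X1 \<inter> X2)"
  shows "unbal_tight (X1 \<union> X2) (F1 \<union> F2)"
proof -
  have "card (F1 \<inter> F2) + 3 \<le> 2 * card (X1 \<inter> X2)"
    using assms edge_verts_Int[of F1 X1 F2 X2] potential_mono[of \<theta> F2 "F1 \<inter> F2"]
    by (intro sparse_card_le_balanced) (auto simp: unbal_tight_def bal_tight_def)
  then show ?thesis
    using assms card_Un_Int[of F1 F2] card_Un_Int[of X1 X2]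
    by (auto simp: unbal_tight_def bal_tight_def)
qed

text \<open>On \<open>F1 \<inter> F2\<close> the sum of the two potentials is constant along edges; if it is not
  constant on \<open>X1 \<inter> X2\<close>, it disconnects the intersection.\<close>

lemma bal_bal_Un_unbal:
  assumes "bal_tight X1 F1 \<theta>1" "bal_tight X2 F2 \<theta>2"
    and "x \<in> X1 \<inter> X2" "y \<in> X1 \<inter> X2" "\<theta>1 x + \<theta>2 x \<noteq> \<theta>1 y + \<theta>2 y"
  shows "unbal_tight (X1 \<union> X2) (F1 \<union> F2)"
proof -
  have "card (F1 \<inter> F2) + 4 \<le> 2 * card (X1 \<inter> X2)"
  proof (rule sparse_card_le_disconnected[OF _ _ assms(3-5)])
    fix u v g assume "(u, v, g) \<in> F1 \<inter> F2"
    then have "\<theta>1 u + \<theta>1 v = \<theta>2 u + \<theta>2 v"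
      using assms(1,2) by (auto simp: bal_tight_def potential_def)
    then show "\<theta>1 u + \<theta>2 u = \<theta>1 v + \<theta>2 v"
      by (metis add.commute add.left_commute bit_add_self(2))
  qed (use assms edge_verts_Int[of F1 X1 F2 X2] in \<open>auto simp: bal_tight_def\<close>)
  then show ?thesis
    using assms card_Un_Int[of F1 F2] card_Un_Int[of X1 X2]
    by (auto simp: unbal_tight_def bal_tight_def)
qed

text \<open>If the potentials agree on the whole intersection, they can be glued. Otherwise they
  agree at \<open>x\<close> and differ at another common vertex, and \<open>bal_bal_Un_unbal\<close>
  applies.\<close>

lemma bal_bal_Un:
  assumes 1: "bal_tight X1 F1 \<theta>1" and 2: "bal_tight X2 F2 \<theta>2"
    and x: "x \<in> X1 \<inter> X2" "\<theta>1 x = \<theta>2 x" and c: "2 \<le> card (X1 \<inter> X2)"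
  shows "unbal_tight (X1 \<union> X2) (F1 \<union> F2) \<or>
    (\<exists>\<theta>. bal_tight (X1 \<union> X2) (F1 \<union> F2) \<theta> \<and> (\<forall>y\<in>X1. \<theta> y = \<theta>1 y) \<and> (\<forall>y\<in>X2. \<theta> y = \<theta>2 y))"
proof (cases "\<forall>y\<in>X1 \<inter> X2. \<theta>1 y = \<theta>2 y")
  case True
  define \<theta> where "\<theta> y = (if y \<in> X1 then \<theta>1 y else \<theta>2 y)" for y
  have agree: "\<forall>y\<in>X1. \<theta> y = \<theta>1 y" "\<forall>y\<in>X2. \<theta> y = \<theta>2 y" using True by (auto simp: \<theta>_def)
  have "potential \<theta> F1" "potential \<theta> F2"
    using 1 2 agree potential_cong[of _ F1 X1 \<theta>] potential_cong[of _ F2 X2 \<theta>]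
    by (auto simp: bal_tight_def)
  moreover have "card (F1 \<inter> F2) + 3 \<le> 2 * card (X1 \<inter> X2)"
    using 1 2 c edge_verts_Int[of F1 X1 F2 X2] potential_mono[of \<theta>2 F2 "F1 \<inter> F2"]
    by (intro sparse_card_le_balanced) (auto simp: bal_tight_def)
  ultimately have "bal_tight (X1 \<union> X2) (F1 \<union> F2) \<theta>"
    using 1 2 card_Un_Int[of F1 F2] card_Un_Int[of X1 X2] by (auto simp: bal_tight_def)
  then show ?thesis using agree by blast
next
  case False
  then obtain y where "y \<in> X1 \<inter> X2" "\<theta>1 y \<noteq> \<theta>2 y" by blast
  then have "\<theta>1 x + \<theta>2 x \<noteq> \<theta>1 y + \<theta>2 y"
    using x by (cases "\<theta>1 y"; cases "\<theta>2 y") auto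
  then show ?thesis using bal_bal_Un_unbal[OF 1 2 x(1)] \<open>y \<in> _\<close> by blast
qed

text \<open>The labels \<open>i\<close> and \<open>j\<close> are the gains of the edges from the removed vertex to \<open>a\<close> and \<open>b\<close>. The
  potential of a balanced blocking set is normalised so that it takes the value \<open>0\<close> at that vertex.\<close>

definition blocked :: "'v \<Rightarrow> bit \<Rightarrow> 'v \<Rightarrow> bit \<Rightarrow> bool" where
  "blocked a i b j \<longleftrightarrow> (\<exists>X F. a \<in> X \<and> b \<in> X \<and> X \<subseteq> insert a (insert b (edge_verts E)) \<and>
     (unbal_tight X F \<or> (\<exists>\<theta>. bal_tight X F \<theta> \<and> \<theta> a = i \<and> \<theta> b = j)))"

text \<open>An edge already present is itself balanced tight on its two ends. Otherwise a set that
  violates sparsity contains the new edge, and it becomes tight once this edge is removed.\<close>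

lemma blockedI:
  assumes nin: "(a, b, i + j) \<in> E \<or> \<not> sparse (insert (a, b, i + j) E)" and ab: "a \<noteq> b"
  shows "blocked a i b j"
proof (cases "(a, b, i + j) \<in> E")
  case True
  define \<theta> where "\<theta> x = (if x = a then i else j)" for x
  have "bal_tight {a, b} {(a, b, i + j)} \<theta>"
    using True ab by (auto simp: bal_tight_def \<theta>_def)
  then show ?thesis using ab unfolding blocked_def
    by (intro exI[of _ "{a, b}"] exI[of _ "{(a, b, i + j)}"]) (auto simp: \<theta>_def)
next
  case False
  let ?e = "(a, b, i + j)"
  obtain F where F: "F \<subseteq> insert ?e E" "F \<noteq> {}"
    and viol: "2 * card (edge_verts F) < card F + 2 \<or>
      (\<exists>\<theta>. potential \<theta> F \<and> 2 * card (edge_verts F) < card F + 3)"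
    using nin False unfolding sparse_def by (auto simp: not_le)
  have "?e \<in> F"
  proof (rule ccontr)
    assume "?e \<notin> F"
    then have "F \<subseteq> E" using F by auto
    then show False using viol F sparse unfolding sparse_def by (metis not_le)
  qed
  define F' X where "F' = F - {?e}" and "X = edge_verts F"
  have F': "F = insert ?e F'" "?e \<notin> F'" "F' \<subseteq> E" using \<open>?e \<in> F\<close> F F'_def by auto
  have cF: "card F = Suc (card F')" using F' by simp
  have X: "a \<in> X" "b \<in> X" "X \<subseteq> insert a (insert b (edge_verts E))" "edge_verts F' \<subseteq> X"
    using edge_verts_mono[OF F'(3)] unfolding X_def F'(1) by auto
  from viol show ?thesis
  proof (elim disjE exE conjE)
    assume "2 * card (edge_verts F) < card F + 2"
    then have "unbal_tight X F'" using F' X cF by (auto simp: unbal_tight_def X_def)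
    then show ?thesis using X unfolding blocked_def by blast
  next
    fix \<theta> assume \<theta>: "potential \<theta> F" "2 * card (edge_verts F) < card F + 3"
    \<comment> \<open>Normalises the potential to \<open>i\<close> at \<open>a\<close>; the gain
      \<open>i + j\<close> of the new edge then forces the value \<open>j\<close> at
      \<open>b\<close>.\<close>
    define \<theta>' where "\<theta>' x = \<theta> x + (\<theta> a + i)" for x
    have p: "i + j = \<theta> a + \<theta> b" "potential \<theta> F'" using \<theta>(1) F'(1) by auto
    have "potential \<theta>' F'"
      using potential_shift[OF p(2), of "\<theta> a + i"] by (simp add: \<theta>'_def[abs_def])
    then have "bal_tight X F' \<theta>'"
      using F' X cF \<theta>(2) by (auto simp: bal_tight_def X_def)
    moreover have "\<theta>' a = i" by (simp add: \<theta>'_def)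
    moreover have "\<theta>' b = j" using p(1) unfolding \<theta>'_def
      by (metis add.commute add.left_commute bit_add_self(2))
    ultimately show ?thesis using X unfolding blocked_def by blast
  qed
qed

text \<open>Three pairwise blocking sets would add up to a set that contains all three neighbours
  and leaves no room for the three edges to \<open>v\<close>.\<close>

lemma not_all_blocked:
  assumes d: "a \<noteq> b" "b \<noteq> c" "a \<noteq> c"
    and K1: "\<And>X F. unbal_tight X F \<Longrightarrow> v \<notin> X \<Longrightarrow> {a, b, c} \<subseteq> X \<Longrightarrow> False"
    and K2: "\<And>X F \<theta>. bal_tight X F \<theta> \<Longrightarrow> v \<notin> X \<Longrightarrow> {a, b, c} \<subseteq> X \<Longrightarrow> \<forall>w\<in>{a, b, c}. \<theta> w = l w \<Longrightarrow> False"
    and v: "v \<notin> edge_verts E" "v \<notin> {a, b, c}"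
    and bl: "blocked a (l a) b (l b)" "blocked b (l b) c (l c)" "blocked c (l c) a (l a)"
  shows False
proof -
  define P where "P X F x y \<longleftrightarrow> x \<in> X \<and> y \<in> X \<and> v \<notin> X \<and>
    (unbal_tight X F \<or> (\<exists>\<theta>. bal_tight X F \<theta> \<and> \<theta> x = l x \<and> \<theta> y = l y))" for X F x y
  have P_sym: "P X F x y \<Longrightarrow> P X F y x" for X F x y unfolding P_def by auto
  have ex: "\<exists>X F. P X F x y" if "blocked x (l x) y (l y)" "{x, y} \<subseteq> {a, b, c}" for x y
    using that v unfolding blocked_def P_def by blast
  obtain X1 F1 where 1: "P X1 F1 a b" using ex[OF bl(1)] by auto
  obtain X2 F2 where 2: "P X2 F2 b c" using ex[OF bl(2)] by auto
  obtain X3 F3 where 3: "P X3 F3 c a" using ex[OF bl(3)] by auto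
  have F: "F \<subseteq> E" "edge_verts F \<subseteq> X" if "P X F x y" for X F x y
    using that by (auto simp: P_def unbal_tight_def bal_tight_def)
  \<comment> \<open>Two blocking sets with two common vertices would have a tight union that
    contains all three neighbours, contrary to \<open>K1\<close> or \<open>K2\<close>. Hence they
    share only the neighbour they have in common.\<close>
  have pair: "X \<inter> X' = {x}" if p: "P X F x y" "P X' F' x z" and xyz: "{x, y, z} = {a, b, c}" for X F X' F' x y z
  proof (rule Int_eq_singletonI)
    have sub: "{a, b, c} \<subseteq> X \<union> X'" "v \<notin> X \<union> X'"
      using p unfolding P_def by (auto simp: xyz[symmetric])
    have U: "\<not> unbal_tight (X \<union> X') (F \<union> F')" using K1 sub by blast
    show "\<not> 2 \<le> card (X \<inter> X')"
    proof
      assume c: "2 \<le> card (X \<inter> X')"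
      have x: "x \<in> X" "x \<in> X'" using p by (auto simp: P_def)
      consider "unbal_tight X F" "unbal_tight X' F'"
        | \<theta> where "unbal_tight X F" "bal_tight X' F' \<theta>"
        | \<theta> where "unbal_tight X' F'" "bal_tight X F \<theta>"
        | \<theta> \<theta>' where "bal_tight X F \<theta>" "\<theta> x = l x" "\<theta> y = l y" "bal_tight X' F' \<theta>'" "\<theta>' x = l x" "\<theta>' z = l z"
        using p unfolding P_def by blast
      then show False
      proof cases
        case 1
        then show False using unbal_unbal_Un[OF 1 x] U by blast
      next
        case 2
        then show False using unbal_bal_Un[OF 2 c] U by blast
      next
        case 3
        have "2 \<le> card (X' \<inter> X)" using c by (simp add: Int_commute)
        from unbal_bal_Un[OF 3 this] show False using U by (simp add: Un_commute)
      next
        case 4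
        obtain \<theta>'' where t: "bal_tight (X \<union> X') (F \<union> F') \<theta>''" "\<forall>w\<in>X. \<theta>'' w = \<theta> w" "\<forall>w\<in>X'. \<theta>'' w = \<theta>' w"
          using bal_bal_Un[OF 4(1,4) _ _ c, of x] x 4 U by auto
        have "\<forall>w\<in>{x, y, z}. \<theta>'' w = l w" using t 4 p unfolding P_def by auto
        then show False using K2[OF t(1) sub(2,1)] xyz by simp
      qed
    qed
  qed (use p in \<open>auto simp: P_def\<close>)
  have 12: "X1 \<inter> X2 = {b}" using pair[OF P_sym[OF 1] 2] by auto
  have 23: "X2 \<inter> X3 = {c}" using pair[OF P_sym[OF 2] 3] by auto
  have 13: "X1 \<inter> X3 = {a}" using pair[OF 1 P_sym[OF 3]] by auto
  \<comment> \<open>A common edge would be a loop at the single common vertex.\<close>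
  have disj: "F \<inter> F' = {}"
    if "X \<inter> X' = {x}" "F \<subseteq> E" "edge_verts F \<subseteq> X" "edge_verts F' \<subseteq> X'" for X X' F F' x
    using sparse_card_le[of "F \<inter> F'" "{x}"] edge_verts_Int[OF that(3,4)] that(1,2) by auto
  have "F1 \<inter> F2 = {}" "F2 \<inter> F3 = {}" "F1 \<inter> F3 = {}"
    using disj[OF 12] disj[OF 23] disj[OF 13] F[OF 1] F[OF 2] F[OF 3] by auto
  then have cF: "card (F1 \<union> F2 \<union> F3) = card F1 + card F2 + card F3"
    by (simp add: card_Un_disjoint Int_Un_distrib2)
  have "(X1 \<union> X2) \<inter> X3 = {a, c}" using 13 23 by auto
  then have cX: "card (X1 \<union> X2 \<union> X3) + 3 = card X1 + card X2 + card X3"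
    using card_Un_Int[of "X1 \<union> X2" X3] card_Un_Int[of X1 X2] 12 d by simp
  have mem: "{a, b, c} \<subseteq> X1 \<union> X2 \<union> X3" "v \<notin> X1 \<union> X2 \<union> X3"
    using 1 2 3 by (auto simp: P_def)
  show False
  \<comment> \<open>The union has three vertices fewer than the sum, which saves 6 in the count. One
    unbalanced set leaves \<open>2 + 3 + 3 - 6 = 2\<close>, which is unbalanced tightness; three
    balanced sets leave \<open>9 - 6 = 3\<close>.\<close>
  proof (cases "unbal_tight X1 F1 \<or> unbal_tight X2 F2 \<or> unbal_tight X3 F3")
    case True
    have "2 * card X1 \<le> card F1 + 3" "2 * card X2 \<le> card F2 + 3" "2 * card X3 \<le> card F3 + 3"
      using 1 2 3 by (auto simp: P_def unbal_tight_def bal_tight_def)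
    then have "2 * (card X1 + card X2 + card X3) \<le> card F1 + card F2 + card F3 + 8"
      using True by (auto simp: unbal_tight_def)
    then have "unbal_tight (X1 \<union> X2 \<union> X3) (F1 \<union> F2 \<union> F3)"
      using F[OF 1] F[OF 2] F[OF 3] cF cX unfolding unbal_tight_def by auto
    then show False using K1 mem by blast
  next
    case False
    obtain \<theta>1 where t1: "bal_tight X1 F1 \<theta>1" "\<theta>1 a = l a" "\<theta>1 b = l b"
      using False 1 unfolding P_def by blast
    obtain \<theta>2 where t2: "bal_tight X2 F2 \<theta>2" "\<theta>2 b = l b" "\<theta>2 c = l c"
      using False 2 unfolding P_def by blast
    obtain \<theta>3 where t3: "bal_tight X3 F3 \<theta>3" "\<theta>3 c = l c" "\<theta>3 a = l a"
      using False 3 unfolding P_def by blast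
    \<comment> \<open>The three potentials fit together because at each shared vertex both take the
      prescribed label.\<close>
    define \<theta> where "\<theta> y = (if y \<in> X1 then \<theta>1 y else if y \<in> X2 then \<theta>2 y else \<theta>3 y)" for y
    have ag1: "\<forall>y\<in>X1. \<theta> y = \<theta>1 y" by (simp add: \<theta>_def)
    have ag2: "\<forall>y\<in>X2. \<theta> y = \<theta>2 y"
    proof
      fix y assume y: "y \<in> X2"
      have "y = b" if "y \<in> X1" using that y 12 by auto
      then show "\<theta> y = \<theta>2 y" using y t1(3) t2(2) unfolding \<theta>_def by presburger
    qed
    have ag3: "\<forall>y\<in>X3. \<theta> y = \<theta>3 y"
    proof
      fix y assume y: "y \<in> X3"
      have "y = a" if "y \<in> X1" using that y 13 by auto
      moreover have "y = c" if "y \<in> X2" using that y 23 by auto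
      ultimately show "\<theta> y = \<theta>3 y" using t1(2) t2(3) t3(2,3) unfolding \<theta>_def by presburger
    qed
    have "potential \<theta> F1" "potential \<theta> F2" "potential \<theta> F3"
      using t1(1) t2(1) t3(1) potential_cong[OF _ F(2)[OF 1] ag1] potential_cong[OF _ F(2)[OF 2] ag2]
        potential_cong[OF _ F(2)[OF 3] ag3] by (auto simp: bal_tight_def)
    moreover have "2 * card X1 \<le> card F1 + 3" "2 * card X2 \<le> card F2 + 3" "2 * card X3 \<le> card F3 + 3"
      using t1(1) t2(1) t3(1) by (auto simp: bal_tight_def)
    ultimately have "bal_tight (X1 \<union> X2 \<union> X3) (F1 \<union> F2 \<union> F3) \<theta>"
      using F[OF 1] F[OF 2] F[OF 3] cF cX unfolding bal_tight_def by auto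
    moreover have "\<theta> a = l a" "\<theta> b = l b" "\<theta> c = l c"
      using ag1 ag2 1 2 t1(2,3) t2(2,3) unfolding P_def by metis+
    ultimately show False using K2 mem by blast
  qed
qed

text \<open>Serves the case of two parallel edges to \<open>a\<close> with different gains. By
  \<open>K1\<close> both blocking sets are balanced; their potentials agree at \<open>b\<close> and
  differ at \<open>a\<close>, so the union is unbalanced tight.\<close>

lemma not_both_blocked:
  assumes d: "a \<noteq> b" "i \<noteq> i'"
    and K1: "\<And>X F. unbal_tight X F \<Longrightarrow> v \<notin> X \<Longrightarrow> a \<in> X \<Longrightarrow> b \<in> X \<Longrightarrow> False"
    and v: "v \<notin> edge_verts E" "v \<noteq> a" "v \<noteq> b"
    and bl: "blocked a i b j" "blocked a i' b j"
  shows False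
proof -
  obtain X1 F1 where 1: "a \<in> X1" "b \<in> X1" "v \<notin> X1"
    "unbal_tight X1 F1 \<or> (\<exists>\<theta>. bal_tight X1 F1 \<theta> \<and> \<theta> a = i \<and> \<theta> b = j)"
    using bl(1) v unfolding blocked_def by blast
  obtain X2 F2 where 2: "a \<in> X2" "b \<in> X2" "v \<notin> X2"
    "unbal_tight X2 F2 \<or> (\<exists>\<theta>. bal_tight X2 F2 \<theta> \<and> \<theta> a = i' \<and> \<theta> b = j)"
    using bl(2) v unfolding blocked_def by blast
  obtain \<theta>1 \<theta>2 where t: "bal_tight X1 F1 \<theta>1" "\<theta>1 a = i" "\<theta>1 b = j"
    "bal_tight X2 F2 \<theta>2" "\<theta>2 a = i'" "\<theta>2 b = j"
    using 1 2 K1 by blast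
  have "\<theta>1 a + \<theta>2 a \<noteq> \<theta>1 b + \<theta>2 b" using t d(2) by (cases i; cases i') auto
  then have "unbal_tight (X1 \<union> X2) (F1 \<union> F2)"
    using bal_bal_Un_unbal[OF t(1,4)] 1 2 by blast
  then show False using K1 1 2 by blast
qed

text \<open>Without loops the degrees add up to twice the number of edges, which by sparsity is less
  than four times the number of vertices.\<close>

lemma sparse_low_degree:
  assumes "E \<noteq> {}"
  obtains v where "v \<in> edge_verts E" "card {e \<in> E. v \<in> edge_verts {e}} \<le> 3"
proof -
  let ?d = "\<lambda>v. card {e \<in> E. v \<in> edge_verts {e}}"
  have "(\<Sum>v\<in>edge_verts E. ?d v) = (\<Sum>v\<in>edge_verts E. \<Sum>e\<in>E. if v \<in> edge_verts {e} then 1 else 0)"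
    by (simp only: card_eq_sum sum.inter_filter[OF finite])
  also have "\<dots> = (\<Sum>e\<in>E. \<Sum>v\<in>edge_verts E. if v \<in> edge_verts {e} then 1 else 0)"
    by (rule sum.swap)
  also have "\<dots> = (\<Sum>e\<in>E. card {v \<in> edge_verts E. v \<in> edge_verts {e}})"
    by (simp only: card_eq_sum sum.inter_filter[OF finite])
  also have "\<dots> = (\<Sum>e\<in>E. 2)"
  proof (rule sum.cong[OF refl])
    fix e assume "e \<in> E"
    obtain x y g where e: "e = (x, y, g)" by (cases e)
    have "{v \<in> edge_verts E. v \<in> edge_verts {e}} = {x, y}" "x \<noteq> y"
      using edge_vertsI[of x y g E] sparse_edge_simple(1)[of x y g] \<open>e \<in> E\<close> e by auto
    then show "card {v \<in> edge_verts E. v \<in> edge_verts {e}} = 2" by simp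
  qed
  also have "\<dots> < (\<Sum>v\<in>edge_verts E. 4)"
    using sparse_card_le[OF subset_refl subset_refl edge_verts_nonempty[OF assms]] by simp
  finally have "\<not> (\<forall>v\<in>edge_verts E. 4 \<le> ?d v)"
    using sum_mono[of "edge_verts E" "\<lambda>_. 4" ?d] by auto
  then obtain v where "v \<in> edge_verts E" "\<not> 4 \<le> ?d v" by blast
  then show ?thesis by (intro that[of v]) auto
qed

end

text \<open>If no replacement works, every pair of distinct neighbours is blocked. The cases
  distinguish how many of the three neighbours coincide.\<close>

lemma degree3_reduction:
  fixes E0 :: "'v::finite gain_edge set"
  assumes sp: "sparse (E0 \<union> D)" and D: "D = {(v, a, i), (v, b, j), (v, c, k)}" "card D = 3"
    and v: "v \<notin> edge_verts E0"
  shows "\<exists>a i b j c k. D = {(v, a, i), (v, b, j), (v, c, k)} \<and> a \<noteq> b \<and>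
    (a, b, i + j) \<notin> E0 \<and> sparse (insert (a, b, i + j) E0)"
proof (rule ccontr)
  assume no: "\<not> ?thesis"
  have sp0: "sparse E0" using sp sparse_mono by blast
  have vn: "v \<notin> {a, b, c}" using sparse_edge_simple(1)[OF sp, of v] D(1) by blast
  have lab: "(a, i) \<noteq> (b, j)" "(a, i) \<noteq> (c, k)" "(b, j) \<noteq> (c, k)"
    using D by (auto simp: card_insert_if split: if_splits)
  have bl: "blocked E0 x m y n"
    if "D = {(v, x, m), (v, y, n), (v, z, l)}" "x \<noteq> y" for x m y n z l
    using no that blockedI[OF sp0] by blast
  have fresh: "F \<inter> D = {}" if "F \<subseteq> E0" for F
    using v that edge_vertsI(1)[of v _ _ E0] D(1) by blast
  have add_D: "card (F \<union> D) = card F + 3" "edge_verts (F \<union> D) \<subseteq> insert v X"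
    "F \<union> D \<subseteq> E0 \<union> D" "card (insert v X) = card X + 1"
    if "F \<subseteq> E0" "edge_verts F \<subseteq> X" "v \<notin> X" "{a, b, c} \<subseteq> X" for F X
  proof -
    show "card (F \<union> D) = card F + 3"
      using card_Un_disjoint[OF finite finite fresh[OF that(1)]] D(2) by simp
    show "edge_verts (F \<union> D) \<subseteq> insert v X"
      unfolding D(1) edge_verts_simps using that by blast
  qed (use that in auto)
  \<comment> \<open>One new vertex makes room for two edges, but \<open>D\<close> has three, so a
    tight set around all neighbours overflows.\<close>
  have K1: "False" if t: "unbal_tight E0 X F" "v \<notin> X" "{a, b, c} \<subseteq> X" for X F
  proof -
    have F: "F \<subseteq> E0" "edge_verts F \<subseteq> X" "2 * card X \<le> card F + 2"
      using t(1) by (simp_all add: unbal_tight_def[OF sp0])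
    note * = add_D[OF F(1,2) t(2,3)]
    show False using sparse_card_le[OF sp *(3,2)] *(1,4) F(3) by simp
  qed
  have K2: "False" if t: "bal_tight E0 X F \<theta>" "v \<notin> X" "{a, b, c} \<subseteq> X"
    and \<theta>: "\<theta> a = i" "\<theta> b = j" "\<theta> c = k" for X F \<theta>
  proof -
    have F: "F \<subseteq> E0" "edge_verts F \<subseteq> X" "potential \<theta> F" "2 * card X \<le> card F + 3"
      using t(1) by (simp_all add: bal_tight_def[OF sp0])
    note * = add_D[OF F(1,2) t(2,3)]
    \<comment> \<open>With the value 0 at \<open>v\<close>, the edges of \<open>D\<close> are
      consistent, since the potential at each neighbour is the gain of the edge to it.\<close>
    have "potential (\<theta>(v := 0)) F"
      using potential_cong[OF F(3,2)] t(2) by simp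
    moreover have "potential (\<theta>(v := 0)) D"
      unfolding D(1) potential_simps using \<theta> vn by auto
    ultimately have "potential (\<theta>(v := 0)) (F \<union> D)" by simp
    moreover have "2 \<le> card (insert v X)" using card_mono[of "insert v X" "{v, a}"] t(3) vn by simp
    ultimately have "card (F \<union> D) + 3 \<le> 2 * card (insert v X)"
      using sparse_card_le_balanced[OF sp *(3,2)] by blast
    then show False using *(1,4) F(4) by simp
  qed
  have double: False
    if xyz: "D = {(v, x, m), (v, x, m'), (v, y, n)}" "x \<noteq> y" "m \<noteq> m'" "{x, y} = {a, b, c}" for x m m' y n
  proof (rule not_both_blocked[OF sp0 xyz(2,3)])
    show "unbal_tight E0 X F \<Longrightarrow> v \<notin> X \<Longrightarrow> x \<in> X \<Longrightarrow> y \<in> X \<Longrightarrow> False" for X F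
      by (rule K1[of X F, folded xyz(4)]) simp_all
    show "v \<notin> edge_verts E0" "v \<noteq> x" "v \<noteq> y" using v vn[folded xyz(4)] by simp_all
    have "D = {(v, x, m), (v, y, n), (v, x, m')}" "D = {(v, x, m'), (v, y, n), (v, x, m)}"
      using xyz(1) by auto
    then show "blocked E0 x m y n" "blocked E0 x m' y n"
      using bl xyz(2) by blast+
  qed
  consider "a \<noteq> b" "b \<noteq> c" "a \<noteq> c" | "a = b" "b \<noteq> c" | "b = c" "a \<noteq> c" | "a = c" "b \<noteq> c" | "a = b" "b = c"
    by blast
  then show False
  proof cases
    case 1
    have rot: "D = {(v, b, j), (v, c, k), (v, a, i)}" "D = {(v, c, k), (v, a, i), (v, b, j)}"
      using D(1) by auto
    let ?l = "\<lambda>x. if x = a then i else if x = b then j else k"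
    show False
    proof (rule not_all_blocked[OF sp0 1, of v ?l])
      show "unbal_tight E0 X F \<Longrightarrow> v \<notin> X \<Longrightarrow> {a, b, c} \<subseteq> X \<Longrightarrow> False" for X F by (rule K1)
      show "bal_tight E0 X F \<theta> \<Longrightarrow> v \<notin> X \<Longrightarrow> {a, b, c} \<subseteq> X \<Longrightarrow> \<forall>w\<in>{a, b, c}. \<theta> w = ?l w \<Longrightarrow> False" for X F \<theta>
        using K2[of X F \<theta>] 1 by simp
      show "v \<notin> edge_verts E0" "v \<notin> {a, b, c}" using v vn by auto
      show "blocked E0 a (?l a) b (?l b)" "blocked E0 b (?l b) c (?l c)" "blocked E0 c (?l c) a (?l a)"
        using bl[of a i b j c k] bl[of b j c k a i] bl[of c k a i b j] 1 D(1) rot by simp_all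
    qed
  next
    case 2
    have "D = {(v, a, i), (v, a, j), (v, c, k)}" using D(1) 2 by auto
    then show False using double[of a i j c k] lab 2 by auto
  next
    case 3
    have "D = {(v, b, j), (v, b, k), (v, a, i)}" using D(1) 3 by auto
    then show False using double[of b j k a i] lab 3 by auto
  next
    case 4
    have "D = {(v, a, i), (v, a, k), (v, b, j)}" using D(1) 4 by auto
    then show False using double[of a i k b j] lab 4 by auto
  next
    case 5
    \<comment> \<open>Three parallel edges would need three different gains, but there are only
      two.\<close>
    then have "i \<noteq> j" "i \<noteq> k" "j \<noteq> k" using lab by auto
    then show False by (metis bit.exhaust)
  qed
qed

text \<open>Allows edges to be reversed at will: modulo 2 this changes neither the ends nor the
  potentials.\<close>

lemma sparse_image:
  fixes E :: "'v::finite gain_edge set"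
  assumes "sparse E" and f: "\<And>x y g. (x, y, g) \<in> E \<Longrightarrow> f (x, y, g) \<in> {(x, y, g), (y, x, g)}"
  shows "sparse (f ` E)" and "inj_on f E"
proof -
  show "sparse (f ` E)"
    unfolding sparse_def
  proof (intro allI impI)
    fix F' assume F': "F' \<subseteq> f ` E \<and> F' \<noteq> {}"
    then obtain F where F: "F \<subseteq> E" "F' = f ` F" using subset_image_iff[of F' f E] by blast
    have ef: "edge_verts {f e} = edge_verts {e}" "potential \<theta> {f e} = potential \<theta> {e}"
      if "e \<in> F" for e \<theta>
    proof -
      obtain x y g where e: "e = (x, y, g)" by (cases e)
      then have "f e = (x, y, g) \<or> f e = (y, x, g)" using f[of x y g] F that by blast
      then show "edge_verts {f e} = edge_verts {e}" "potential \<theta> {f e} = potential \<theta> {e}"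
        unfolding e by (elim disjE; simp add: insert_commute add.commute)+
    qed
    have V: "edge_verts F' = edge_verts F"
      unfolding F(2) edge_verts_UN[of "f ` F"] edge_verts_UN[of F] using ef(1) by simp
    have P: "potential \<theta> F' \<longleftrightarrow> potential \<theta> F" for \<theta>
      unfolding F(2) potential_Ball[of _ "f ` F"] potential_Ball[of _ F] using ef(2) by simp
    have "card F' \<le> card F" using F(2) by (simp add: card_image_le)
    moreover have "card F + 2 \<le> 2 * card (edge_verts F)"
      "(\<exists>\<theta>. potential \<theta> F) \<longrightarrow> card F + 3 \<le> 2 * card (edge_verts F)"
      using assms(1) F(1) F' unfolding sparse_def F(2) by blast+
    ultimately show "card F' + 2 \<le> 2 * card (edge_verts F') \<and>
      ((\<exists>\<theta>. potential \<theta> F') \<longrightarrow> card F' + 3 \<le> 2 * card (edge_verts F'))"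
      unfolding V P by auto
  qed
  show "inj_on f E"
  proof (rule inj_onI)
    fix e e' assume e: "e \<in> E" "e' \<in> E" "f e = f e'"
    obtain x y g x' y' g' where [simp]: "e = (x, y, g)" "e' = (x', y', g')" by (cases e, cases e')
    show "e = e'"
      using f[of x y g] f[of x' y' g'] e sparse_edge_simple(2)[OF assms(1)] by auto
  qed
qed

section \<open>Balance and potentials\<close>

lemma traversals_simps [simp]:
  "verts (traversals H) = verts H"
  "arcs (traversals H) = arcs H \<times> UNIV"
  "tail (traversals H) (e, d) = (if d then tail H e else head H e)"
  "head (traversals H) (e, d) = (if d then head H e else tail H e)"
  by (simp_all add: traversals_def)

lemma wf_digraph_traversals:
  assumes "wf_digraph H"
  shows "wf_digraph (traversals H)"
proof -
  interpret wf_digraph H by (rule assms)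
  show ?thesis by unfold_locales (auto simp: split: if_splits)
qed

text \<open>The sum telescopes, every inner vertex contributing its potential twice.\<close>

lemma cycle_gain_eq_potential:
  fixes \<psi> :: "'e \<Rightarrow> bit"
  assumes "\<forall>e\<in>F. \<psi> e = \<theta> (tail H e) + \<theta> (head H e)"
    and "pre_digraph.cas (traversals H) u c v" and "fst ` set c \<subseteq> F"
  shows "cycle_gain \<psi> c = \<theta> u + \<theta> v"
  using assms(2,3)
proof (induction c arbitrary: u)
  case Nil
  then show ?case by (simp add: cycle_gain_def pre_digraph.cas.simps)
next
  case (Cons a c)
  obtain e d where a: "a = (e, d)" by (cases a)
  from Cons.prems have "tail (traversals H) a = u" "e \<in> F"
    and IH: "cycle_gain \<psi> c = \<theta> (head (traversals H) a) + \<theta> v"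
    using Cons.IH by (auto simp: pre_digraph.cas.simps a)
  moreover from this have "\<psi> e = \<theta> u + \<theta> (head (traversals H) a)"
    using assms(1) by (cases d) (auto simp: a add.commute)
  moreover have "cycle_gain \<psi> (a # c) = \<psi> e + cycle_gain \<psi> c"
    by (simp add: cycle_gain_def a)
  ultimately show ?case by (simp add: add.assoc)
qed

lemma balanced_if_potential:
  fixes \<psi> :: "'e \<Rightarrow> bit"
  assumes "\<forall>e\<in>F. \<psi> e = \<theta> (tail H e) + \<theta> (head H e)"
  shows "balanced H \<psi> F"
  unfolding balanced_def
proof (intro allI impI)
  fix c assume c: "gain_cycle H c \<and> fst ` set c \<subseteq> F"
  then obtain u where "pre_digraph.awalk (traversals H) u c u"
    unfolding gain_cycle_def pre_digraph.cycle_def by blast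
  then have "pre_digraph.cas (traversals H) u c u" by (simp add: pre_digraph.awalk_def)
  from cycle_gain_eq_potential[OF assms this] c show "cycle_gain \<psi> c = 0" by simp
qed

text \<open>A second traversal of an edge, in either direction, would return to the vertex where the
  first one started.\<close>

lemma apath_traversals_distinct:
  assumes "wf_digraph H"
    and "pre_digraph.awalk (traversals H) u p v"
    and "distinct (pre_digraph.awalk_verts (traversals H) u p)"
  shows "distinct (map fst p)"
proof -
  interpret G: wf_digraph "traversals H" by (rule wf_digraph_traversals[OF assms(1)])
  show ?thesis using assms(2,3)
  proof (induction p arbitrary: u)
    case (Cons a p)
    let ?w = "head (traversals H) a"
    have p: "G.awalk ?w p v" "distinct (G.awalk_verts ?w p)"
      and u: "u = tail (traversals H) a" "u \<notin> set (G.awalk_verts ?w p)"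
      using Cons.prems by (auto simp: G.awalk_Cons_iff)
    have "fst a \<noteq> fst b" if "b \<in> set p" for b
    proof
      assume "fst a = fst b"
      then have "u = tail (traversals H) b \<or> u = head (traversals H) b"
        unfolding u(1) by (cases a; cases b) auto
      then show False
        using G.awalk_verts_arc1[OF that, of ?w] G.awalk_verts_arc2[OF p(1) that] u(2) by auto
    qed
    then show ?case using Cons.IH[OF p] by auto
  qed simp
qed

text \<open>Edges are added one at a time. If \<open>F\<close> already connects the ends of
  \<open>e\<close>, a path between them closes up with \<open>e\<close> to a balanced cycle, and the
  old potential fits. Otherwise it is shifted on one component.\<close>

lemma potential_if_balanced:
  fixes \<psi> :: "'e \<Rightarrow> bit" and H :: "('v, 'e) pre_digraph"
  assumes "wf_digraph H" "finite F" "F \<subseteq> arcs H" "balanced H \<psi> F"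
  shows "\<exists>\<theta>. \<forall>e\<in>F. \<psi> e = \<theta> (tail H e) + \<theta> (head H e)"
  using assms(2-4)
proof (induction F rule: finite_induct)
  case (insert e F)
  interpret H: wf_digraph H by (rule assms(1))
  interpret G: wf_digraph "traversals H" by (rule wf_digraph_traversals[OF assms(1)])
  have "balanced H \<psi> F" using insert.prems(2) unfolding balanced_def by blast
  then obtain \<theta> where \<theta>: "\<forall>e\<in>F. \<psi> e = \<theta> (tail H e) + \<theta> (head H e)"
    using insert by auto
  \<comment> \<open>The connected component of the head of \<open>e\<close> in
    \<open>F\<close>.\<close>
  define conn where "conn x \<longleftrightarrow> (\<exists>p. G.awalk (head H e) p x \<and> fst ` set p \<subseteq> F)" for x
  have step: "conn y" if "conn x" "f \<in> F" "G.awalk x [(f, d)] y" for x y f d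
  proof -
    obtain p where p: "G.awalk (head H e) p x" "fst ` set p \<subseteq> F" using \<open>conn x\<close> conn_def by auto
    then have "G.awalk (head H e) (p @ [(f, d)]) y" using that(3) by (rule_tac G.awalk_appendI)
    then show ?thesis using p(2) that(2) unfolding conn_def
      by (intro exI[of _ "p @ [(f, d)]"]) auto
  qed
  have conn_iff: "conn (tail H f) \<longleftrightarrow> conn (head H f)" if f: "f \<in> F" for f
  proof -
    have "f \<in> arcs H" using f insert.prems(1) by auto
    then have "G.awalk (tail H f) [(f, True)] (head H f)" "G.awalk (head H f) [(f, False)] (tail H f)"
      by (auto simp: G.awalk_def pre_digraph.cas.simps)
    then show ?thesis using step f by blast
  qed
  have eH: "e \<in> arcs H" using insert.prems(1) by simp
  have "conn (head H e)" unfolding conn_def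
    by (rule exI[of _ "[]"]) (use eH in \<open>simp add: G.awalk_def pre_digraph.cas.simps \<close>)
  show ?case
  proof (cases "conn (tail H e)")
    case True
    then obtain p where "G.awalk (head H e) p (tail H e)" "fst ` set p \<subseteq> F"
      unfolding conn_def by blast
    then obtain p where p: "G.apath (head H e) p (tail H e)" "fst ` set p \<subseteq> F"
      using G.apath_awalk_to_apath G.awalk_to_apath_subset by (meson image_mono order_trans)
    let ?c = "(e, True) # p"
    have pw: "G.awalk (head H e) p (tail H e)" "distinct (G.awalk_verts (head H e) p)"
      using p(1) by (auto simp: G.apath_def)
    have "G.awalk (tail H e) ?c (tail H e)"
      using pw(1) eH unfolding G.awalk_Cons_iff by simp
    moreover have "distinct (tl (G.awalk_verts (tail H e) ?c))"
      using pw(2) by simp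
    ultimately have "G.cycle ?c" unfolding G.cycle_def by blast
    moreover have "distinct (map fst ?c)"
      using apath_traversals_distinct[OF assms(1) pw] p(2) insert.hyps(2) by force
    ultimately have "cycle_gain \<psi> ?c = 0"
      using insert.prems(2) p(2) unfolding balanced_def gain_cycle_def by fastforce
    moreover have "cycle_gain \<psi> ?c = \<psi> e + cycle_gain \<psi> p" by (simp add: cycle_gain_def)
    moreover have "cycle_gain \<psi> p = \<theta> (head H e) + \<theta> (tail H e)"
      using cycle_gain_eq_potential[OF \<theta> _ p(2)] pw(1) by (simp add: G.awalk_def)
    ultimately have "\<psi> e = \<theta> (tail H e) + \<theta> (head H e)"
      by (metis add.commute add.left_neutral bit_add_self)
    then show ?thesis using \<theta> by auto
  next
    case False
    \<comment> \<open>The defect of the old potential on \<open>e\<close>. Adding it on the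
      component of the head repairs \<open>e\<close>, while edges of \<open>F\<close> have both ends
      shifted or neither.\<close>
    define k where "k = \<psi> e + \<theta> (tail H e) + \<theta> (head H e)"
    define \<theta>' where "\<theta>' x = (if conn x then \<theta> x + k else \<theta> x)" for x
    have "\<psi> f = \<theta>' (tail H f) + \<theta>' (head H f)" if "f \<in> F" for f
    proof -
      have "a + k + (b + k) = a + b" for a b :: bit
        by (cases a; cases b; cases k) auto
      then show ?thesis using \<theta> that conn_iff[OF that] by (auto simp: \<theta>'_def)
    qed
    moreover have "\<psi> e = \<theta>' (tail H e) + \<theta>' (head H e)"
    proof -
      have "a = t + (h + (a + t + h))" for a t h :: bit
        by (cases a; cases t; cases h) auto
      then show ?thesis using False \<open>conn (head H e)\<close> by (simp add: \<theta>'_def k_def)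
    qed
    ultimately show ?thesis by auto
  qed
qed simp

section \<open>Placements with independent rows\<close>

lemma axis_linear:
  "axis i (x + y) = axis i x + axis i (y :: 'a::real_vector)"
  "axis i (x - y) = axis i x - axis i y"
  "axis i (- x) = - axis i x"
  "axis i (c *\<^sub>R x) = c *\<^sub>R axis i x"
  by (simp_all add: vec_eq_iff axis_def)

text \<open>The expression is a polynomial of degree at most 2 in \<open>t\<close> that does not
  vanish at \<open>t = 1\<close>.\<close>

lemma finite_zeros_bilinear:
  fixes L :: "'a::real_inner \<Rightarrow> 'a"
  assumes L: "linear L" and nz: "L (a + b) \<bullet> (c + d) \<noteq> 0"
  shows "finite {t. L (a + t *\<^sub>R b) \<bullet> (c + t *\<^sub>R d) = 0}"
proof -
  interpret linear L by (rule L)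
  let ?p = "[: L a \<bullet> c, L b \<bullet> c + L a \<bullet> d, L b \<bullet> d :]"
  have eq: "L (a + t *\<^sub>R b) \<bullet> (c + t *\<^sub>R d) = poly ?p t" for t
    by (simp add: linear_add[OF L] linear_cmul[OF L] inner_add_left inner_add_right ring_distribs)
  have "poly ?p 1 \<noteq> 0" using nz eq[of 1] by simp
  then have "?p \<noteq> 0" by (metis poly_0)
  then show ?thesis unfolding eq by (rule poly_roots_finite)
qed

lemma midpoint_diff:
  fixes A B :: "'a::real_vector"
  shows "(1/2) *\<^sub>R (A + B) - A = (1/2) *\<^sub>R (B - A)" "(1/2) *\<^sub>R (A + B) - B = - ((1/2) *\<^sub>R (B - A))"
proof -
  have "(1/2) *\<^sub>R A + (1/2) *\<^sub>R A = A" for A :: 'a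
    by (simp add: scaleR_left_distrib[symmetric])
  from this[of A] this[of B] show "(1/2) *\<^sub>R (A + B) - A = (1/2) *\<^sub>R (B - A)"
    "(1/2) *\<^sub>R (A + B) - B = - ((1/2) *\<^sub>R (B - A))"
    by (simp_all add: scaleR_add_right scaleR_diff_right algebra_simps)
qed

section \<open>The rotation by a right angle\<close>

definition rot90 :: "real^2 \<Rightarrow> real^2" where
  "rot90 x = vector [- (x $ 2), x $ 1]"

lemma linear_rot90: "linear rot90"
  by (rule linearI) (simp_all add: rot90_def vec_eq_iff forall_2)

lemmas rot90_linear = linear_add[OF linear_rot90] linear_diff[OF linear_rot90]
  linear_neg[OF linear_rot90] linear_cmul[OF linear_rot90] linear_0[OF linear_rot90]

lemma rot90_simps [simp]:
  "rot90 (rot90 x) = - x"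
  "rot90 x \<bullet> rot90 y = x \<bullet> y"
  "rot90 x \<bullet> x = 0"
  "x \<bullet> rot90 x = 0"
  by (simp_all add: rot90_def vec_eq_iff forall_2 inner_vec_def sum_2)

lemma rot90_inner: "x \<bullet> rot90 y = - (rot90 x \<bullet> y)"
  by (simp add: rot90_def inner_vec_def sum_2)

text \<open>\<open>rot90 u \<bullet> w\<close> is the determinant of \<open>u\<close> and
  \<open>w\<close>. Pairing the relation with \<open>rot90 u\<close> and with \<open>rot90 w\<close>
  isolates the coefficients.\<close>

lemma rot90_inner_indep:
  assumes "rot90 u \<bullet> w \<noteq> 0" and "a *\<^sub>R u + b *\<^sub>R w = 0"
  shows "a = 0" "b = 0"
proof -
  have "rot90 u \<bullet> (a *\<^sub>R u + b *\<^sub>R w) = 0" "rot90 w \<bullet> (a *\<^sub>R u + b *\<^sub>R w) = 0"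
    using assms(2) by simp_all
  then have "b * (rot90 u \<bullet> w) = 0" "a * (rot90 w \<bullet> u) = 0"
    by (simp_all add: inner_add_right)
  moreover have "rot90 w \<bullet> u = - (rot90 u \<bullet> w)"
    by (metis inner_commute rot90_inner)
  ultimately show "a = 0" "b = 0" using assms(1) by simp_all
qed

lemma bit_sign_mult: "bit_sign (g + h) = bit_sign g * bit_sign h"
  by (cases g; cases h; simp add: bit_sign_def)

lemma bit_sign_square [simp]: "bit_sign g * bit_sign g = 1" "bit_sign g * (bit_sign g * x) = x"
  by (simp_all add: bit_sign_def)

lemma bit_sign_nonzero [simp]: "bit_sign g \<noteq> 0"
  by (simp add: bit_sign_def)

section \<open>The reflection and its twisted representation\<close>

locale Cs_representation =
  fixes \<tau> :: "bit \<Rightarrow> real^2^2" and n :: "real^2"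
  assumes n_nonzero [simp]: "n \<noteq> 0" and tau_0: "\<tau> 0 = mat 1" and tau_1: "\<tau> 1 = reflection_matrix n"
begin

definition T :: "bit \<Rightarrow> real^2 \<Rightarrow> real^2" where "T g x = \<tau> g *v x"

text \<open>The representation \<open>T\<close> twisted by the sign character; it is the one under which the
  entries of a row of \<open>O_1\<close> at the two ends of an edge correspond to each other.\<close>

definition S :: "bit \<Rightarrow> real^2 \<Rightarrow> real^2" where "S g x = bit_sign g *\<^sub>R T g x"

lemma linear_T: "linear (T g)"
  unfolding T_def[abs_def] by simp

lemma linear_S: "linear (S g)"
  unfolding S_def[abs_def] by (intro linear_compose_scale_right linear_T)

lemmas T_linear = linear_add[OF linear_T] linear_diff[OF linear_T] linear_neg[OF linear_T]
  linear_cmul[OF linear_T] linear_0[OF linear_T]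
lemmas S_linear = linear_add[OF linear_S] linear_diff[OF linear_S] linear_neg[OF linear_S]
  linear_cmul[OF linear_S] linear_0[OF linear_S]

lemma T_0 [simp]: "T 0 x = x"
  by (simp add: T_def tau_0)

lemma T_1: "T 1 x = x - (2 * (x \<bullet> n) / (n \<bullet> n)) *\<^sub>R n"
proof -
  have "linear (\<lambda>x. x - (2 * (x \<bullet> n) / (n \<bullet> n)) *\<^sub>R n)"
    by (rule linearI) (simp_all add: inner_add_left algebra_simps add_divide_distrib)
  then show ?thesis unfolding T_def tau_1 reflection_matrix_def
    by (simp add: matrix_works matrix_vector_mul)
qed

lemma T_1_n: "T 1 n = - n"
  by (simp add: T_1 scaleR_2)

lemma T_1_rot90_n: "T 1 (rot90 n) = rot90 n"
  by (simp add: T_1)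

lemma T_involution [simp]: "T g (T g x) = x"
proof (cases "g = 0")
  case False
  have "T 1 x \<bullet> n = - (x \<bullet> n)" by (simp add: T_1 inner_diff_left)
  then have "T 1 (T 1 x) = T 1 x + (2 * (x \<bullet> n) / (n \<bullet> n)) *\<^sub>R n"
    using T_1[of "T 1 x"] by simp
  then show ?thesis using False by (simp add: T_1)
qed simp

lemma T_add: "T (g + h) x = T g (T h x)"
  by (cases g; cases h) simp_all

lemma T_adjoint: "T g x \<bullet> y = x \<bullet> T g y"
  by (cases "g = 0") (simp_all add: T_1 inner_diff_left inner_diff_right inner_commute)

lemma T_inner: "T g x \<bullet> T g y = x \<bullet> y"
  by (simp add: T_adjoint)

lemma S_involution [simp]: "S g (S g x) = x"
  by (simp add: S_def T_linear)

lemma S_0 [simp]: "S 0 x = x"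
  by (simp add: S_def bit_sign_def)

lemma S_add: "S (g + h) x = S g (S h x)"
  by (simp add: S_def T_add T_linear bit_sign_mult)

text \<open>The reflection negates its normal and the sign undoes this. Hence translations along
  \<open>n\<close> are compatible with all gains.\<close>

lemma S_n: "S g n = n"
  by (cases g) (simp_all add: S_def T_1_n bit_sign_def)

text \<open>A reflection reverses orientation, so the rotation commutes with it up to sign; the
  twist by the sign character absorbs this sign.\<close>

lemma rot90_T: "rot90 (T g x) = S g (rot90 x)"
proof (cases "g = 0")
  case False
  define k l where "k = (x \<bullet> n) / (n \<bullet> n)" and "l = (rot90 x \<bullet> n) / (n \<bullet> n)"
  \<comment> \<open>The expansion of \<open>rot90 x\<close> in the orthogonal basis
    \<open>rot90 n\<close>, \<open>n\<close>; the first coefficient is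
    \<open>rot90 x \<bullet> rot90 n = x \<bullet> n\<close>.\<close>
  have "(n \<bullet> n) *\<^sub>R rot90 x = (x \<bullet> n) *\<^sub>R rot90 n + (rot90 x \<bullet> n) *\<^sub>R n"
    by (simp add: vec_eq_iff forall_2 inner_vec_def sum_2 rot90_def) (simp add: algebra_simps)
  then have "inverse (n \<bullet> n) *\<^sub>R (n \<bullet> n) *\<^sub>R rot90 x =
      inverse (n \<bullet> n) *\<^sub>R ((x \<bullet> n) *\<^sub>R rot90 n + (rot90 x \<bullet> n) *\<^sub>R n)" by simp
  then have h: "rot90 x = k *\<^sub>R rot90 n + l *\<^sub>R n"
    by (simp add: k_def l_def scaleR_add_right divide_inverse mult.commute)
  have "rot90 (T 1 x) = rot90 x - (2 * k) *\<^sub>R rot90 n"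
    by (simp add: T_1 rot90_linear k_def)
  also have "\<dots> = - rot90 x + (2 * l) *\<^sub>R n"
    unfolding h by (simp add: vec_eq_iff algebra_simps)
  also have "\<dots> = S 1 (rot90 x)"
    by (simp add: S_def bit_sign_def T_1 l_def)
  finally have "rot90 (T 1 x) = S 1 (rot90 x)" .
  then show ?thesis using False by simp
qed simp

lemma matrix_inv_tau: "matrix_inv (\<tau> g) = \<tau> g"
proof -
  have inv: "\<tau> g ** \<tau> g = mat 1"
    using T_involution[of g] by (simp add: matrix_eq T_def matrix_vector_mul_assoc)
  show ?thesis unfolding matrix_inv_def
  proof (rule some_equality)
    fix A assume A: "\<tau> g ** A = mat 1 \<and> A ** \<tau> g = mat 1"
    then have "\<tau> g ** (\<tau> g ** A) = \<tau> g" by simp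
    then show "A = \<tau> g" by (simp add: matrix_mul_assoc inv)
  qed (simp add: inv)
qed

section \<open>Rows of the orbit matrix \<open>O_1\<close>\<close>

definition trow :: "('v::finite \<Rightarrow> real^2) \<Rightarrow> 'v gain_edge \<Rightarrow> (real^2)^'v" where
  "trow p = (\<lambda>(u, v, g). axis u (p u - T g (p v)) - axis v (S g (p u - T g (p v))))"

text \<open>Both entries come from the single vector \<open>p u - T g (p v)\<close>: the one at the
  head is minus its image under \<open>S g\<close>.\<close>

lemma orbit_row_eq_trow: "orbit_row \<tau> H \<psi> p e = trow p (tail H e, head H e, \<psi> e)"
proof -
  have "bit_sign (\<psi> e) *\<^sub>R (p (head H e) - T (\<psi> e) (p (tail H e))) =
      - S (\<psi> e) (p (tail H e) - T (\<psi> e) (p (head H e)))"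
    by (simp add: S_def T_linear algebra_simps)
  then show ?thesis
    by (simp add: orbit_row_def trow_def vec_eq_iff axis_def matrix_inv_tau T_def[symmetric])
qed

text \<open>Along a line of placements each row traces a line, so the results on pencils
  apply.\<close>

lemma trow_affine: "trow (\<lambda>v. p v + t *\<^sub>R q v) e = trow p e + t *\<^sub>R trow q e"
proof -
  obtain u v g where e: "e = (u, v, g)" by (cases e)
  have d: "p u + t *\<^sub>R q u - T g (p v + t *\<^sub>R q v) = (p u - T g (p v)) + t *\<^sub>R (q u - T g (q v))"
    by (simp add: T_linear scaleR_diff_right)
  have "axis u (x + t *\<^sub>R y) - axis v (S g (x + t *\<^sub>R y)) =
      axis u x - axis v (S g x) + t *\<^sub>R (axis u y - axis v (S g y))" for x y
    by (simp add: S_linear axis_linear scaleR_diff_right)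
  then show ?thesis unfolding e trow_def split d .
qed

lemma trow_flip: "trow p (v, u, g) = bit_sign g *\<^sub>R trow p (u, v, g)"
proof -
  have d: "p v - T g (p u) = - T g (p u - T g (p v))" by (simp add: T_linear)
  have "axis v (- T g d) - axis u (S g (- T g d)) = bit_sign g *\<^sub>R (axis u d - axis v (S g d))" for d
    by (simp add: S_def axis_linear T_linear(3) scaleR_diff_right)
  then show ?thesis unfolding trow_def split d .
qed

lemma trow_upd:
  assumes "e \<in> E" "v \<notin> edge_verts E"
  shows "trow (p(v := z)) e = trow p e" "trow p e $ v = 0"
proof -
  obtain x y g where e: "e = (x, y, g)" by (cases e)
  then have "x \<noteq> v" "y \<noteq> v" using assms edge_vertsI[of x y g E] by auto
  then show "trow (p(v := z)) e = trow p e" "trow p e $ v = 0"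
    by (simp_all add: e trow_def axis_def)
qed

definition row_indep :: "'v::finite gain_edge set \<Rightarrow> ('v \<Rightarrow> real^2) \<Rightarrow> bool" where
  "row_indep E p \<longleftrightarrow> inj_on (trow p) E \<and> independent (trow p ` E)"

lemma row_indep_iff:
  "row_indep E p \<longleftrightarrow> (\<forall>c. (\<Sum>e\<in>E. c e *\<^sub>R trow p e) = 0 \<longrightarrow> (\<forall>e\<in>E. c e = 0))"
  unfolding row_indep_def by (rule inj_on_independent_image_iff) simp

lemma row_indep_mono: "row_indep E p \<Longrightarrow> E' \<subseteq> E \<Longrightarrow> row_indep E' p"
  unfolding row_indep_def by (meson independent_mono image_mono inj_on_subset)

section \<open>Placements in general position\<close>

definition pt :: "('v \<Rightarrow> real^2) \<Rightarrow> 'v \<times> bit \<Rightarrow> real^2" where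
  "pt p = (\<lambda>(v, g). T g (p v))"

text \<open>The condition concerns all points of the covering framework, mirror images included. The
  nonzero determinants say that no three of them are collinear.\<close>

definition general_position :: "('v \<Rightarrow> real^2) \<Rightarrow> bool" where
  "general_position p \<longleftrightarrow> inj (pt p) \<and>
     (\<forall>x y z. distinct [x, y, z] \<longrightarrow> rot90 (pt p y - pt p x) \<bullet> (pt p z - pt p x) \<noteq> 0)"

text \<open>Points on a parabola whose axis is the mirror.\<close>

lemma general_position_exists: "\<exists>p :: 'v::finite \<Rightarrow> real^2. general_position p"
proof -
  obtain f :: "'v \<Rightarrow> nat" where f: "inj f"
    using finite_imp_inj_to_nat_seg[OF finite[of "UNIV :: 'v set"]] by blast
  \<comment> \<open>The parameter on the parabola. The added 1 keeps it away from 0, so that the two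
    copies of a vertex have distinct, opposite parameters.\<close>
  define s where "s x = bit_sign (snd x) * (real (f (fst x)) + 1)" for x :: "'v \<times> bit"
  have s: "s x \<noteq> s y" if "x \<noteq> y" for x y
  proof
    assume eq: "s x = s y"
    obtain v g w h where xy [simp]: "x = (v, g)" "y = (w, h)" by (cases x, cases y)
    have "g = h"
      using eq by (cases g; cases h) (auto simp: s_def bit_sign_def)
    moreover from this have "f v = f w" using eq by (simp add: s_def)
    ultimately show False using f that by (simp add: inj_eq)
  qed
  define P where "P r = r *\<^sub>R n + r\<^sup>2 *\<^sub>R rot90 n" for r
  define p where "p v = P (real (f v) + 1)" for v
  have pt: "pt p x = P (s x)" for x
  proof -
    obtain v g where "x = (v, g)" by (cases x)
    then show ?thesis
      by (cases g) (simp_all add: pt_def p_def P_def s_def bit_sign_def T_linear T_1_n T_1_rot90_n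
          power2_eq_square algebra_simps)
  qed
  \<comment> \<open>A Vandermonde determinant.\<close>
  have cr: "rot90 (P b - P a) \<bullet> (P c - P a) = (n \<bullet> n) * ((b - a) * (c - a) * (c - b))" for a b c
    by (simp add: P_def rot90_linear inner_diff_left inner_diff_right inner_add_left inner_add_right)
      (simp add: algebra_simps power2_eq_square)
  have "P a \<noteq> P b" if "a \<noteq> b" for a b
  proof
    assume "P a = P b"
    then have "P a \<bullet> n = P b \<bullet> n" by simp
    then show False using that by (simp add: P_def inner_add_left)
  qed
  then have "inj (pt p)" using s unfolding inj_def pt by metis
  moreover have "rot90 (pt p y - pt p x) \<bullet> (pt p z - pt p x) \<noteq> 0" if "distinct [x, y, z]" for x y z
    using that s[of y x] s[of z x] s[of z y] unfolding pt cr by auto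
  ultimately show ?thesis unfolding general_position_def by blast
qed

lemma linear_id_real_inner: "linear (\<lambda>x. x :: real^2)"
  by (rule linearI) simp_all

lemma finite_not_row_indep_line:
  assumes "row_indep E p"
  shows "finite {t. \<not> row_indep E (\<lambda>v. p v + t *\<^sub>R q v)}"
  using finite_dependent_pencil[of E "trow p" "trow q"] assms
  unfolding row_indep_def trow_affine[abs_def] by simp

text \<open>On the line from \<open>q\<close> to a placement in general position, independence holds
  at \<open>t = 0\<close> and general position at \<open>t = 1\<close>. Each of the finitely many
  conditions fails for finitely many \<open>t\<close> only.\<close>

lemma row_indep_general_position:
  assumes "row_indep E q"
  shows "\<exists>p. row_indep E p \<and> general_position p"
proof -
  obtain p0 :: "'a \<Rightarrow> real^2" where p0: "general_position p0" using general_position_exists by blast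
  define d where "d v = p0 v - q v" for v
  let ?p = "\<lambda>t v. q v + t *\<^sub>R d v"
  have pt: "pt (?p t) x = pt q x + t *\<^sub>R (pt p0 x - pt q x)" for t x
    by (cases x) (simp add: pt_def d_def T_linear)
  let ?B1 = "{t. \<not> row_indep E (?p t)}"
  let ?B2 = "\<Union>x. \<Union>y\<in>{y. y \<noteq> x}. {t. pt (?p t) y = pt (?p t) x}"
  let ?B3 = "\<Union>x. \<Union>y. \<Union>z\<in>{z. distinct [x, y, z]}.
    {t. rot90 (pt (?p t) y - pt (?p t) x) \<bullet> (pt (?p t) z - pt (?p t) x) = 0}"
  have fin1: "finite ?B1" by (rule finite_not_row_indep_line[OF assms])
  have fin2: "finite {t. pt (?p t) y = pt (?p t) x}" if "y \<noteq> x" for x y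
  proof -
    let ?a = "pt q y - pt q x" and ?b = "(pt p0 y - pt q y) - (pt p0 x - pt q x)"
    have ab: "pt (?p t) y - pt (?p t) x = ?a + t *\<^sub>R ?b" for t
      unfolding pt by (simp add: algebra_simps)
    have "?a + ?b \<noteq> 0" using p0 that by (auto simp: general_position_def inj_eq)
    \<comment> \<open>Coincidence of two points is a zero of their squared distance.\<close>
    then have "finite {t. (?a + t *\<^sub>R ?b) \<bullet> (?a + t *\<^sub>R ?b) = 0}"
      by (intro finite_zeros_bilinear[OF linear_id_real_inner]) simp
    moreover have "{t. pt (?p t) y = pt (?p t) x} \<subseteq> {t. (?a + t *\<^sub>R ?b) \<bullet> (?a + t *\<^sub>R ?b) = 0}"
      unfolding ab[symmetric] by auto
    ultimately show ?thesis by (rule finite_subset[rotated])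
  qed
  have finB2: "finite ?B2" by (intro finite_UN_I finite fin2) simp
  have fin3: "finite {t. rot90 (pt (?p t) y - pt (?p t) x) \<bullet> (pt (?p t) z - pt (?p t) x) = 0}"
    if "distinct [x, y, z]" for x y z
  proof -
    let ?a = "\<lambda>y. pt q y - pt q x" and ?b = "\<lambda>y. (pt p0 y - pt q y) - (pt p0 x - pt q x)"
    have ab: "pt (?p t) y - pt (?p t) x = ?a y + t *\<^sub>R ?b y" for t y
      unfolding pt by (simp add: algebra_simps)
    have s: "?a y + ?b y = pt p0 y - pt p0 x" for y by simp
    have "rot90 (?a y + ?b y) \<bullet> (?a z + ?b z) \<noteq> 0"
      using p0 that unfolding s general_position_def by blast
    then show ?thesis unfolding ab by (rule finite_zeros_bilinear[OF linear_rot90])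
  qed
  have finB3: "finite ?B3" by (intro finite_UN_I finite fin3) simp
  have fin: "finite (?B1 \<union> ?B2 \<union> ?B3)" by (intro finite_UnI fin1 finB2 finB3)
  obtain t where t: "t \<notin> ?B1 \<union> ?B2 \<union> ?B3"
    using ex_new_if_finite[OF infinite_UNIV_char_0 fin] by (elim exE)
  then have t12: "t \<notin> ?B1" "t \<notin> ?B2" and t3: "t \<notin> ?B3" unfolding Un_iff by argo+
  have "row_indep E (?p t)" using t12(1) unfolding mem_Collect_eq by argo
  moreover have "general_position (?p t)"
    unfolding general_position_def
  proof
    have "pt (?p t) y \<noteq> pt (?p t) x" if "y \<noteq> x" for x y
    proof
      assume "pt (?p t) y = pt (?p t) x"
      then have "t \<in> ?B2"
        by (intro UN_I[OF UNIV_I[of x]] UN_I[of y "{y. y \<noteq> x}"] CollectI that)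
      then show False using t12(2) by argo
    qed
    then show "inj (pt (?p t))" by (intro injI) metis
    show "\<forall>x y z. distinct [x, y, z] \<longrightarrow>
        rot90 (pt (?p t) y - pt (?p t) x) \<bullet> (pt (?p t) z - pt (?p t) x) \<noteq> 0"
    proof (intro allI impI notI)
      fix x y z assume "distinct [x, y, z]"
        "rot90 (pt (?p t) y - pt (?p t) x) \<bullet> (pt (?p t) z - pt (?p t) x) = 0"
      then have "t \<in> ?B3"
        by (intro UN_I[OF UNIV_I[of x]] UN_I[OF UNIV_I[of y]] UN_I[of z "{z. distinct [x, y, z]}"] CollectI)
      then show False using t3 by argo
    qed
  qed
  ultimately show ?thesis by blast
qed

subsection \<open>Henneberg extensions\<close>

lemma trow_component:
  assumes "a \<noteq> v"
  shows "trow p (v, a, g) $ v = p v - T g (p a)"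
  using assms by (simp add: trow_def axis_def)

lemma sum_new_edges:
  fixes E0 :: "'v::finite gain_edge set"
  assumes v: "v \<notin> edge_verts E0" and D: "D \<subseteq> {v} \<times> UNIV"
  shows "(\<Sum>e\<in>E0 \<union> D. c e *\<^sub>R trow (q(v := z)) e) =
    (\<Sum>e\<in>E0. c e *\<^sub>R trow q e) + (\<Sum>e\<in>D. c e *\<^sub>R trow (q(v := z)) e)"
proof -
  have "E0 \<inter> D = {}" using v D edge_vertsI(1)[of v _ _ E0] by auto
  moreover have "(\<Sum>e\<in>E0. c e *\<^sub>R trow (q(v := z)) e) = (\<Sum>e\<in>E0. c e *\<^sub>R trow q e)"
    using trow_upd(1)[OF _ v] by (intro sum.cong) auto
  ultimately show "(\<Sum>e\<in>E0 \<union> D. c e *\<^sub>R trow (q(v := z)) e) =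
    (\<Sum>e\<in>E0. c e *\<^sub>R trow q e) + (\<Sum>e\<in>D. c e *\<^sub>R trow (q(v := z)) e)"
    by (simp add: sum.union_disjoint)
qed

lemma sum_old_edges_component:
  fixes E0 :: "'v::finite gain_edge set"
  assumes "v \<notin> edge_verts E0"
  shows "(\<Sum>e\<in>E0. c e *\<^sub>R trow q e) $ v = 0"
  using trow_upd(2)[OF _ assms] by (simp add: sum_component)

text \<open>If \<open>v\<close> is not collinear with the covering points \<open>A\<close> and
  \<open>B\<close>, the entries at \<open>v\<close> force both new coefficients to vanish. The
  neighbours may coincide, since two copies of a vertex are distinct points.\<close>

lemma zero_extension:
  assumes ind: "row_indep E0 q" and gp: "general_position q"
    and v: "v \<notin> edge_verts E0" "a \<noteq> v" "b \<noteq> v" and ab: "(a, i) \<noteq> (b, j)"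
  shows "\<exists>p. row_indep (E0 \<union> {(v, a, i), (v, b, j)}) p"
proof -
  define A B where "A = T i (q a)" and "B = T j (q b)"
  have AB: "B - A \<noteq> 0"
    using gp ab unfolding general_position_def A_def B_def pt_def inj_def by fastforce
  \<comment> \<open>This point off the line \<open>AB\<close> makes the determinant below equal to
    the squared distance of \<open>A\<close> and \<open>B\<close>.\<close>
  define p where "p = q(v := A + rot90 (B - A))"
  let ?D = "{(v, a, i), (v, b, j)}"
  have "\<forall>e\<in>E0 \<union> ?D. c e = 0" if s: "(\<Sum>e\<in>E0 \<union> ?D. c e *\<^sub>R trow p e) = 0" for c
  proof -
    have s': "(\<Sum>e\<in>E0. c e *\<^sub>R trow q e)
        + (c (v, a, i) *\<^sub>R trow p (v, a, i) + c (v, b, j) *\<^sub>R trow p (v, b, j)) = 0"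
      using s ab unfolding p_def by (subst (asm) sum_new_edges[OF v(1)]) auto
    have "trow p (v, a, i) $ v = rot90 (B - A)"
      using trow_component[OF v(2), of p i] v(2) by (simp add: p_def A_def)
    moreover have "trow p (v, b, j) $ v = rot90 (B - A) - (B - A)"
      using trow_component[OF v(3), of p j] v(3) by (simp add: p_def B_def)
    ultimately have "c (v, a, i) *\<^sub>R rot90 (B - A) + c (v, b, j) *\<^sub>R (rot90 (B - A) - (B - A)) = 0"
      using arg_cong[OF s', of "\<lambda>x. x $ v"] sum_old_edges_component[OF v(1), of c q] by simp
    moreover have "rot90 (rot90 (B - A)) \<bullet> (rot90 (B - A) - (B - A)) \<noteq> 0"
    proof -
      have "rot90 (rot90 x) \<bullet> (rot90 x - x) = x \<bullet> x" for x by (simp add: inner_diff_right)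
      then show ?thesis using AB by (metis inner_eq_zero_iff)
    qed
    ultimately have "c (v, a, i) = 0" "c (v, b, j) = 0"
      using rot90_inner_indep by blast+
    moreover from this have "\<forall>e\<in>E0. c e = 0" using s' ind unfolding row_indep_iff by simp
    ultimately show ?thesis by auto
  qed
  then show ?thesis unfolding row_indep_iff by blast
qed

text \<open>With \<open>v\<close> placed in the middle of the edge \<open>ab\<close>, the rows of the two halves of this edge
  add up to a multiple of its own row.\<close>

lemma trow_split:
  fixes q :: "'v::finite \<Rightarrow> real^2"
  assumes "v \<noteq> a" "v \<noteq> b" and p: "p = q(v := (1/2) *\<^sub>R (T i (q a) + T j (q b)))"
  shows "trow p (v, a, i) + trow p (v, b, j) = (bit_sign i / 2) *\<^sub>R trow q (a, b, i + j)"
proof -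
  define A B where "A = T i (q a)" and "B = T j (q b)"
  have half: "p v - A = (1/2) *\<^sub>R (B - A)" "p v - B = - ((1/2) *\<^sub>R (B - A))"
    using midpoint_diff[of A B] by (simp_all add: p A_def B_def)
  have "trow p (v, a, i) + trow p (v, b, j) =
      (axis v (p v - A) + axis v (p v - B)) - axis a (S i (p v - A)) - axis b (S j (p v - B))"
    using assms(1,2) by (simp add: trow_def p A_def B_def)
  also have "\<dots> = axis b ((1/2) *\<^sub>R S j (B - A)) - axis a ((1/2) *\<^sub>R S i (B - A))"
    unfolding half by (simp add: axis_linear(1)[symmetric] axis_linear(3) S_linear(4) S_linear(3))
  also have "\<dots> = (bit_sign i / 2) *\<^sub>R trow q (a, b, i + j)"
  proof -
    have d: "q a - T (i + j) (q b) = - T i (B - A)"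
      by (simp add: T_linear T_add A_def B_def)
    have "S (i + j) (- T i (B - A)) = - (bit_sign i *\<^sub>R S j (B - A))"
      by (simp add: S_def T_linear(3) bit_sign_mult T_add[of j i] add.commute[of i j])
    then show ?thesis
      unfolding trow_def split d
      by (simp add: axis_linear S_def[of i "B - A"] scaleR_diff_right)
  qed
  finally show ?thesis .
qed

text \<open>As \<open>C\<close> is not on the line \<open>AB\<close>, the entries at
  \<open>v\<close> annihilate the coefficient of the third edge and equate the other two. By
  \<open>trow_split\<close> what remains is a relation among the rows of the smaller graph.\<close>

lemma one_extension:
  assumes ind: "row_indep (insert (a, b, i + j) E0) q" and new: "(a, b, i + j) \<notin> E0"
    and gp: "general_position q"
    and v: "v \<notin> edge_verts E0" "a \<noteq> v" "b \<noteq> v" "c \<noteq> v"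
    and lab: "distinct [(a, i), (b, j), (c, k)]"
  shows "\<exists>p. row_indep (E0 \<union> {(v, a, i), (v, b, j), (v, c, k)}) p"
proof -
  define A B C where "A = T i (q a)" and "B = T j (q b)" and "C = T k (q c)"
  have ABC: "rot90 (B - A) \<bullet> (C - A) \<noteq> 0"
    using gp lab unfolding general_position_def A_def B_def C_def pt_def by fastforce
  define M where "M = (1/2) *\<^sub>R (A + B)"
  define p where "p = q(v := M)"
  let ?D = "{(v, a, i), (v, b, j), (v, c, k)}"
  have "\<forall>e\<in>E0 \<union> ?D. w e = 0" if s: "(\<Sum>e\<in>E0 \<union> ?D. w e *\<^sub>R trow p e) = 0" for w
  proof -
    let ?a = "w (v, a, i)" and ?b = "w (v, b, j)" and ?c = "w (v, c, k)"
    have "(\<Sum>e\<in>?D. w e *\<^sub>R trow p e) =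
        ?a *\<^sub>R trow p (v, a, i) + ?b *\<^sub>R trow p (v, b, j) + ?c *\<^sub>R trow p (v, c, k)"
      using lab by (subst sum.insert; force)+
    then have s': "(\<Sum>e\<in>E0. w e *\<^sub>R trow q e) + (?a *\<^sub>R trow p (v, a, i)
        + ?b *\<^sub>R trow p (v, b, j) + ?c *\<^sub>R trow p (v, c, k)) = 0"
      using s sum_new_edges[OF v(1), of ?D w q M] unfolding p_def by simp
    have "trow p (v, a, i) $ v = (1/2) *\<^sub>R (B - A)"
      using trow_component[OF v(2), of p i] v(2) midpoint_diff(1)[of A B] by (simp add: p_def M_def A_def)
    moreover have "trow p (v, b, j) $ v = - ((1/2) *\<^sub>R (B - A))"
      using trow_component[OF v(3), of p j] v(3) midpoint_diff(2)[of A B] by (simp add: p_def M_def B_def)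
    moreover have "trow p (v, c, k) $ v = M - C"
      using trow_component[OF v(4), of p k] v(4) by (simp add: p_def C_def)
    ultimately have "((?a - ?b) / 2) *\<^sub>R (B - A) + ?c *\<^sub>R (M - C) = 0"
      using arg_cong[OF s', of "\<lambda>x. x $ v"] sum_old_edges_component[OF v(1), of w q]
      by (simp add: scaleR_left_diff_distrib diff_divide_distrib)
    moreover have "rot90 (B - A) \<bullet> (M - C) \<noteq> 0"
    proof -
      have mc: "M - C = (1/2) *\<^sub>R (B - A) - (C - A)"
        using midpoint_diff(1)[of A B] unfolding M_def by (simp add: algebra_simps)
      have rx: "rot90 x \<bullet> ((1/2) *\<^sub>R x - y) = - (rot90 x \<bullet> y)" for x y
        by (simp add: inner_diff_right)
      show ?thesis unfolding mc rx using ABC by simp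
    qed
    ultimately have "(?a - ?b) / 2 = 0" and c0: "?c = 0"
      using rot90_inner_indep by blast+
    then have ab: "?b = ?a" by simp
    let ?e = "(a, b, i + j)"
    \<comment> \<open>The common coefficient of the two halves, rescaled as in
      \<open>trow_split\<close>, becomes the coefficient of the replaced edge.\<close>
    define w' where "w' = w(?e := ?a * (bit_sign i / 2))"
    have "?a *\<^sub>R trow p (v, a, i) + ?b *\<^sub>R trow p (v, b, j) = w' ?e *\<^sub>R trow q ?e"
      unfolding ab scaleR_add_right[symmetric] w'_def
      using trow_split[of v a b p q i j] v by (simp add: p_def M_def A_def B_def)
    moreover have "(\<Sum>e\<in>E0. w e *\<^sub>R trow q e) = (\<Sum>e\<in>E0. w' e *\<^sub>R trow q e)"
      using new by (intro sum.cong) (auto simp: w'_def)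
    ultimately have "(\<Sum>e\<in>insert ?e E0. w' e *\<^sub>R trow q e) = 0"
      using s' c0 new by (simp add: add.commute)
    then have z: "\<forall>e\<in>insert ?e E0. w' e = 0" using ind unfolding row_indep_iff by blast
    then have "?a = 0" by (simp add: w'_def)
    moreover have "\<forall>e\<in>E0. w e = 0"
    proof
      fix e assume "e \<in> E0"
      then show "w e = 0" using z new by (cases "e = ?e") (auto simp: w'_def)
    qed
    ultimately show ?thesis using ab c0 by auto
  qed
  then show ?thesis unfolding row_indep_iff by blast
qed

section \<open>Independent placements of sparse sets\<close>

lemma row_indep_reorient:
  assumes f: "\<And>x y g. (x, y, g) \<in> E \<Longrightarrow> f (x, y, g) \<in> {(x, y, g), (y, x, g)}"
    and inj: "inj_on f E" and ind: "row_indep (f ` E) p"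
  shows "row_indep E p"
  unfolding row_indep_iff
proof (intro allI impI)
  fix c assume s: "(\<Sum>e\<in>E. c e *\<^sub>R trow p e) = 0"
  \<comment> \<open>By \<open>trow_flip\<close> a reversal only changes the sign of the row, and
    only for the nontrivial gain.\<close>
  have "\<exists>s. s \<noteq> 0 \<and> trow p e = s *\<^sub>R trow p (f e)" if e: "e \<in> E" for e
  proof -
    obtain x y g where [simp]: "e = (x, y, g)" by (cases e)
    consider "f e = e" | "f e = (y, x, g)" using f[of x y g] e by auto
    then show ?thesis
    proof cases
      case 1 then show ?thesis by (intro exI[of _ 1]) simp
    next
      case 2 then show ?thesis using trow_flip[of p x y g] by (intro exI[of _ "bit_sign g"]) simp
    qed
  qed
  then obtain s where sg: "\<And>e. e \<in> E \<Longrightarrow> s e \<noteq> 0 \<and> trow p e = s e *\<^sub>R trow p (f e)" by metis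
  define c' where "c' x = c (inv_into E f x) * s (inv_into E f x)" for x
  have "(\<Sum>x\<in>f ` E. c' x *\<^sub>R trow p x) = (\<Sum>e\<in>E. c e *\<^sub>R trow p e)"
    unfolding sum.reindex[OF inj] using sg inj by (intro sum.cong) (auto simp: c'_def)
  then have "\<forall>x\<in>f ` E. c' x = 0" using s ind unfolding row_indep_iff by simp
  then show "\<forall>e\<in>E. c e = 0" using sg inj by (auto simp: c'_def)
qed

text \<open>A vertex of degree 1 to 3 is removed, with a replacement edge in degree 3. The smaller
  graph has an independent placement in general position, and the extension lemmas reinsert the
  vertex.\<close>

lemma sparse_imp_row_indep:
  fixes E :: "'v::finite gain_edge set"
  assumes "sparse E"
  shows "\<exists>p. row_indep E p"
  using assms
proof (induction "card E" arbitrary: E rule: less_induct)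
  case less
  have IH: "\<exists>q. row_indep E' q \<and> general_position q" if "card E' < card E" "sparse E'"
    for E' :: "'v gain_edge set"
    using less.hyps[OF that] row_indep_general_position by blast
  show ?case
  proof (cases "E = {}")
    case True
    then have "row_indep E (\<lambda>_. 0)" by (simp add: row_indep_iff)
    then show ?thesis by blast
  next
    case False
    obtain v where v: "v \<in> edge_verts E" "card {e \<in> E. v \<in> edge_verts {e}} \<le> 3"
      using sparse_low_degree[OF less.prems False] .
    \<comment> \<open>Directs all edges at \<open>v\<close> away from \<open>v\<close>, the form
      that the extension lemmas expect.\<close>
    define f where "f = (\<lambda>(x, y, g). if y = v then (y, x, g) else (x, y, g :: bit))"
    have f: "f (x, y, g) \<in> {(x, y, g), (y, x, g)}" for x y g by (simp add: f_def)
    define E0 where "E0 = {e \<in> E. v \<notin> edge_verts {e}}"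
    define D where "D = f ` {e \<in> E. v \<in> edge_verts {e}}"
    have inj: "inj_on f E" and sp: "sparse (f ` E)" using sparse_image[OF less.prems f] by auto
    define D' where "D' = {e \<in> E. v \<in> edge_verts {e}}"
    have E: "E = E0 \<union> D'" "E0 \<inter> D' = {}" by (auto simp: E0_def D'_def)
    have "f e = e" if "e \<in> E0" for e using that by (cases e) (auto simp: E0_def f_def)
    then have "f ` E0 = E0" by force
    then have fE: "f ` E = E0 \<union> D"
      unfolding D_def D'_def[symmetric] by (subst E(1)) (simp only: image_Un)
    have sp0: "sparse E0" using sp sparse_mono unfolding fE by blast
    have vE0: "v \<notin> edge_verts E0" by (subst edge_verts_UN) (auto simp: E0_def)
    have inj': "inj_on f D'" using inj by (rule inj_on_subset) (auto simp: D'_def)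
    have cD: "card D = card D'"
      unfolding D_def D'_def[symmetric] by (rule card_image[OF inj'])
    have cE: "card E = card E0 + card D"
      unfolding cD using card_Un_disjoint[OF finite finite E(2)] E(1) by simp
    have Dv: "\<exists>a g. e = (v, a, g) \<and> a \<noteq> v" if eD: "e \<in> D" for e
    proof -
      obtain e' where e': "e' \<in> E" "v \<in> edge_verts {e'}" "e = f e'"
        using eD unfolding D_def by blast
      obtain x y g where "e' = (x, y, g)" by (cases e')
      with e' have xyz: "(x, y, g) \<in> E" "v \<in> {x, y}" "e = f (x, y, g)" by simp_all
      then show ?thesis using sparse_edge_simple(1)[OF less.prems xyz(1)] by (auto simp: f_def)
    qed
    have "card D \<noteq> 0"
    proof -
      obtain e where "e \<in> E" "v \<in> edge_verts {e}"
        using v(1) unfolding edge_verts_UN[of E] by (elim UN_E)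
      then have "D' \<noteq> {}" unfolding D'_def by blast
      then show ?thesis unfolding cD by simp
    qed
    then consider "card D = 1" | "card D = 2" | "card D = 3" using v(2) cD unfolding D'_def by linarith
    then have "\<exists>p. row_indep (E0 \<union> D) p"
    proof cases
      case 1
      then obtain a g where D: "D = {(v, a, g)}" "a \<noteq> v"
        using Dv by (metis card_1_singletonE insertI1)
      obtain q where q: "row_indep E0 q" "general_position q" using IH[of E0] sp0 cE 1 by auto
      \<comment> \<open>A single edge is completed by its parallel edge of the other gain, which is
        dropped again afterwards.\<close>
      obtain p where "row_indep (E0 \<union> {(v, a, g), (v, a, g + 1)}) p"
        using zero_extension[OF q vE0 D(2) D(2), of g "g + 1"] by auto
      then have "row_indep (E0 \<union> D) p" by (rule row_indep_mono) (simp add: D(1), blast)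
      then show ?thesis by blast
    next
      case 2
      then obtain d d' where "D = {d, d'}" "d \<noteq> d'" by (meson card_2_iff)
      moreover obtain a i where "d = (v, a, i)" "a \<noteq> v" using Dv[of d] calculation by auto
      moreover obtain b j where "d' = (v, b, j)" "b \<noteq> v" using Dv[of d'] calculation by auto
      ultimately have D: "D = {(v, a, i), (v, b, j)}" "a \<noteq> v" "b \<noteq> v" "(a, i) \<noteq> (b, j)" by auto
      obtain q where q: "row_indep E0 q" "general_position q" using IH[of E0] sp0 cE 2 by auto
      show ?thesis using zero_extension[OF q vE0 D(2-4)] D(1) by simp
    next
      case 3
      then obtain d d' d'' where ddd: "D = {d, d', d''}" by (metis card_3_iff)
      obtain a i where d: "d = (v, a, i)" using Dv[of d] ddd by auto
      obtain b j where d': "d' = (v, b, j)" using Dv[of d'] ddd by auto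
      obtain c k where d'': "d'' = (v, c, k)" using Dv[of d''] ddd by auto
      obtain a i b j c k where D: "D = {(v, a, i), (v, b, j), (v, c, k)}"
        and new: "(a, b, i + j) \<notin> E0" "sparse (insert (a, b, i + j) E0)"
        using degree3_reduction[OF sp[unfolded fE] ddd[unfolded d d' d''] 3 vE0] by blast
      have nv: "a \<noteq> v" "b \<noteq> v" "c \<noteq> v" 
        using Dv[of "(v, a, i)"] Dv[of "(v, b, j)"] Dv[of "(v, c, k)"] D by simp_all
      have lab: "distinct [(a, i), (b, j), (c, k)]"
        using 3 unfolding D by (auto simp: card_insert_if split: if_splits)
      have "card (insert (a, b, i + j) E0) < card E" using cE 3 new(1) by simp
      then obtain q where q: "row_indep (insert (a, b, i + j) E0) q" "general_position q"
        using IH new(2) by blast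
      show ?thesis using one_extension[OF q(1) new(1) q(2) vE0 nv lab] D by simp
    qed
    then show ?thesis using row_indep_reorient[OF f inj] unfolding fE by blast
  qed
qed

end

section \<open>Necessity of sparsity\<close>

context Cs_representation
begin

lemma S_adjoint: "S g x \<bullet> y = x \<bullet> S g y"
  by (simp add: S_def T_adjoint)

lemma trow_nonzero:
  assumes "row_indep E p" "(u, v, g) \<in> E"
  shows "p u - T g (p v) \<noteq> 0"
proof
  assume "p u - T g (p v) = 0"
  then have "trow p (u, v, g) = axis u 0 - axis v (S g 0)" by (simp only: trow_def split)
  then have "trow p (u, v, g) = 0" by (simp add: S_linear axis_def vec_eq_iff)
  then have "0 \<in> trow p ` E" using assms(2) by force
  then show False using assms(1) dependent_zero unfolding row_indep_def by blast
qed

text \<open>A rotation plus a translation. The motion annihilates the rows if the translation vectors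
  \<open>S (\<theta> v) w\<close> are compatible with the gains.\<close>

definition motion ::
  "'v set \<Rightarrow> ('v::finite \<Rightarrow> bit) \<Rightarrow> ('v \<Rightarrow> real^2) \<Rightarrow> real \<times> (real^2) \<Rightarrow> (real^2)^'v" where
  "motion X \<theta> p z = (\<chi> v. if v \<in> X then fst z *\<^sub>R rot90 (p v) + S (\<theta> v) (snd z) else 0)"

lemma linear_motion: "linear (motion X \<theta> p)"
  by (rule linearI) (simp_all add: motion_def vec_eq_iff S_linear algebra_simps)

text \<open>Moving the self-adjoint \<open>S g\<close> to the other side cancels the translations.
  The rotations leave \<open>c *\<^sub>R rot90 d\<close>, which is orthogonal to the edge vector
  \<open>d\<close>.\<close>

lemma motion_orthogonal:
  assumes "u \<in> X" "v \<in> X" "S (g + \<theta> v) w = S (\<theta> u) w"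
  shows "motion X \<theta> p (c, w) \<bullet> trow p (u, v, g) = 0"
proof -
  define d where "d = p u - T g (p v)"
  have "motion X \<theta> p (c, w) \<bullet> trow p (u, v, g) =
      (c *\<^sub>R rot90 (p u) + S (\<theta> u) w) \<bullet> d - (c *\<^sub>R rot90 (p v) + S (\<theta> v) w) \<bullet> S g d"
    using assms(1,2) by (simp add: trow_def d_def motion_def inner_diff_right inner_axis)
  also have "\<dots> = ((c *\<^sub>R rot90 (p u) + S (\<theta> u) w) - S g (c *\<^sub>R rot90 (p v) + S (\<theta> v) w)) \<bullet> d"
    by (simp add: inner_diff_left S_adjoint)
  also have "(c *\<^sub>R rot90 (p u) + S (\<theta> u) w) - S g (c *\<^sub>R rot90 (p v) + S (\<theta> v) w) = c *\<^sub>R rot90 d"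
    using assms(3) by (simp add: S_linear S_add d_def rot90_linear rot90_T scaleR_diff_right)
  finally show ?thesis by simp
qed

text \<open>The rows live on the vertices of \<open>F\<close>, in a space of dimension at most
  \<open>2 * card (edge_verts F)\<close>, and are orthogonal to a space of motions of dimension
  \<open>1 + dim W\<close>.\<close>

lemma row_indep_card_bound:
  fixes F :: "'v::finite gain_edge set"
  assumes ind: "row_indep F p" and ne: "F \<noteq> {}" and W: "subspace W"
    and comp: "\<And>u v g w. (u, v, g) \<in> F \<Longrightarrow> w \<in> W \<Longrightarrow> S (g + \<theta> v) w = S (\<theta> u) w"
  shows "card F + (1 + dim W) \<le> 2 * card (edge_verts F)"
proof -
  let ?X = "edge_verts F"
  let ?m = "motion ?X \<theta> p"
  define U where "U = {m :: (real^2)^'v. \<forall>w. w \<notin> ?X \<longrightarrow> m $ w = 0}"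
  have "subspace U" by (auto simp: U_def subspace_def)
  have UW: "subspace (UNIV \<times> W)" using W by (simp add: subspace_Times)
  define M where "M = ?m ` (UNIV \<times> W)"
  have M: "subspace M" unfolding M_def
    by (rule linear_subspace_image[OF linear_motion UW])
  have MU: "M \<subseteq> U" by (auto simp: M_def U_def motion_def)
  obtain u v g where e: "(u, v, g) \<in> F" using ne by (metis ex_in_conv prod_cases3)
  have uv: "u \<in> ?X" "v \<in> ?X" using edge_vertsI[OF e] by auto
  \<comment> \<open>If a motion vanishes at both ends of an edge, comparing the two values removes
    the translation. The edge vector is nonzero, so the rotation vanishes, and then so does the
    translation.\<close>
  have "inj_on ?m (UNIV \<times> W)"
  proof (subst linear_inj_on_iff_eq_0[OF linear_motion UW], intro ballI impI)
    fix z assume z: "z \<in> UNIV \<times> W" "?m z = 0"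
    obtain c w where cw: "z = (c, w)" by (cases z)
    have 0: "c *\<^sub>R rot90 (p x) + S (\<theta> x) w = 0" if "x \<in> ?X" for x
      using arg_cong[OF z(2), of "\<lambda>m. m $ x"] that by (simp add: motion_def cw)
    have "S g (c *\<^sub>R rot90 (p v) + S (\<theta> v) w) = 0" using 0[OF uv(2)] by (simp add: S_linear)
    then have "c *\<^sub>R rot90 (T g (p v)) + S (\<theta> u) w = 0"
      using comp[OF e, of w] z(1) by (simp add: cw S_linear rot90_T S_add)
    with 0[OF uv(1)] have "c *\<^sub>R (rot90 (p u) - rot90 (T g (p v))) = 0"
      unfolding scaleR_diff_right by (metis add_right_cancel right_minus_eq)
    then have "c *\<^sub>R rot90 (p u - T g (p v)) = 0" by (simp add: rot90_linear)
    moreover have "rot90 (p u - T g (p v)) \<noteq> 0"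
      using trow_nonzero[OF ind e] by (metis inner_eq_zero_iff rot90_simps(2))
    ultimately have c: "c = 0" by simp
    then have "S (\<theta> u) (S (\<theta> u) w) = S (\<theta> u) 0" using 0[OF uv(1)] by simp
    then show "z = 0" using c by (simp add: cw S_linear zero_prod_def)
  qed
  then have "dim M = dim ((UNIV :: real set) \<times> W)"
    unfolding M_def by (intro dim_image_eq[OF linear_motion]) (simp add: span_eq_iff[THEN iffD2, OF UW])
  then have dM: "dim M = 1 + dim W"
    using dim_Times[OF subspace_UNIV W, where 'a = real] by simp
  let ?B = "(\<lambda>(w, b). axis w b) ` (?X \<times> (Basis :: (real^2) set))"
  have "U \<subseteq> span ?B"
  proof
    fix m assume m: "m \<in> U"
    have "m = (\<Sum>w\<in>?X. axis w (m $ w))"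
    proof -
      have "(\<Sum>w\<in>?X. axis w (m $ w)) $ i = (\<Sum>w\<in>?X. if i = w then m $ w else 0)" for i
        by (simp add: sum_component axis_def)
      then show ?thesis using m by (simp add: vec_eq_iff U_def)
    qed
    moreover have "axis w x \<in> span ?B" if "w \<in> ?X" for w x
    proof -
      have "axis w x = axis w (\<Sum>b\<in>Basis. (x \<bullet> b) *\<^sub>R b)" by (simp add: euclidean_representation)
      also have "\<dots> = (\<Sum>b\<in>Basis. (x \<bullet> b) *\<^sub>R axis w b)"
        by (simp add: vec_eq_iff axis_def sum_component)
      also have "\<dots> \<in> span ?B"
        using that by (intro span_sum span_scale span_base) force
      finally show ?thesis .
    qed
    ultimately show "m \<in> span ?B" using span_sum[of ?X "\<lambda>w. axis w (m $ w)" ?B] by metis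
  qed
  then have "dim U \<le> card ?B" by (intro dim_le_card) auto
  also have "\<dots> \<le> card (?X \<times> (Basis :: (real^2) set))" by (rule card_image_le) simp
  finally have dU: "dim U \<le> 2 * card ?X" by (simp add: card_cartesian_product)
  have "trow p ` F \<subseteq> {y \<in> U. \<forall>x\<in>M. orthogonal x y}"
  proof (clarsimp, intro conjI ballI)
    fix x y h assume e: "(x, y, h) \<in> F"
    then have xy: "x \<in> ?X" "y \<in> ?X" by (auto dest: edge_vertsI)
    then show "trow p (x, y, h) \<in> U" by (auto simp: U_def trow_def axis_def)
    show "orthogonal m (trow p (x, y, h))" if "m \<in> M" for m
      using that motion_orthogonal[OF xy] comp[OF e] unfolding M_def orthogonal_def by auto
  qed
  then have "dim (trow p ` F) \<le> dim {y \<in> U. \<forall>x\<in>M. orthogonal x y}" by (rule dim_subset)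
  moreover have "dim (trow p ` F) = card F"
    using ind by (simp add: row_indep_def dim_eq_card_independent card_image)
  ultimately show ?thesis
    using dim_subspace_orthogonal_to_vectors[OF M \<open>subspace U\<close> MU] dM dU by simp
qed

text \<open>The translations along \<open>n\<close> suit every \<open>F\<close>. For balanced
  \<open>F\<close> the potential makes all translations compatible, which raises the dimension of
  the motions to 3.\<close>

lemma row_indep_imp_sparse:
  assumes "row_indep E p"
  shows "sparse E"
  unfolding sparse_def
proof (intro allI impI conjI; (elim exE)?)
  fix F assume F: "F \<subseteq> E \<and> F \<noteq> {}"
  then have ind: "row_indep F p" using assms row_indep_mono by blast
  have "S h w = w" if "w \<in> span {n}" for h w
    using that S_n by (auto simp: span_singleton S_linear)
  then have "card F + (1 + dim (span {n})) \<le> 2 * card (edge_verts F)"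
    using F by (intro row_indep_card_bound[OF ind, where \<theta> = "\<lambda>_. 0"]) auto
  then show "card F + 2 \<le> 2 * card (edge_verts F)" by simp
  fix \<theta> assume \<theta>: "potential \<theta> F"
  have "S (g + \<theta> v) w = S (\<theta> u) w" if "(u, v, g) \<in> F" for u v g w
  proof -
    have "g = \<theta> u + \<theta> v" using \<theta> that by (auto simp: potential_def)
    then have "g + \<theta> v = \<theta> u" by (simp add: add.assoc)
    then show ?thesis by simp
  qed
  then have "card F + (1 + dim (UNIV :: (real^2) set)) \<le> 2 * card (edge_verts F)"
    using F by (intro row_indep_card_bound[OF ind, of _ \<theta>]) auto
  then show "card F + 3 \<le> 2 * card (edge_verts F)" by simp
qed

end

section \<open>From digraphs to sets of gain edges\<close>

definition gain_edge :: "('v, 'e) pre_digraph \<Rightarrow> ('e \<Rightarrow> bit) \<Rightarrow> 'e \<Rightarrow> 'v gain_edge" where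
  "gain_edge H \<psi> e = (tail H e, head H e, \<psi> e)"

lemma edge_verts_gain_edge: "edge_verts (gain_edge H \<psi> ` F) = endpoints H F"
  by (auto simp: edge_verts_def gain_edge_def endpoints_def)

lemma potential_gain_edge:
  "potential \<theta> (gain_edge H \<psi> ` F) \<longleftrightarrow> (\<forall>e\<in>F. \<psi> e = \<theta> (tail H e) + \<theta> (head H e))"
  by (auto simp: potential_def gain_edge_def)

text \<open>Injectivity keeps track of multiplicities: two arcs with equal ends and gain would form
  a balanced set with too many edges. Balance is translated into the existence of a
  potential.\<close>

lemma gain_sparse_iff:
  fixes H :: "('v::finite, 'e) pre_digraph"
  assumes "fin_digraph H"
  shows "gain_sparse 2 3 2 H \<psi> \<longleftrightarrow> inj_on (gain_edge H \<psi>) (arcs H) \<and> sparse (gain_edge H \<psi> ` arcs H)"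
    (is "?L \<longleftrightarrow> ?R")
proof
  interpret fin_digraph H by (rule assms)
  let ?\<eta> = "gain_edge H \<psi>"
  assume L: ?L
  have sp: "card F + 2 \<le> 2 * card (endpoints H F)" if "F \<subseteq> arcs H" "F \<noteq> {}" for F
  proof -
    have "int (card F) \<le> int 2 * int (card (endpoints H F)) - int 2"
      using L that unfolding gain_sparse_def by blast
    then show ?thesis by linarith
  qed
  have bal: "card F + 3 \<le> 2 * card (endpoints H F)"
    if "F \<subseteq> arcs H" "F \<noteq> {}" "\<forall>e\<in>F. \<psi> e = \<theta> (tail H e) + \<theta> (head H e)" for F \<theta>
  proof -
    have "int (card F) \<le> int 2 * int (card (endpoints H F)) - int 3"
      using L that(1,2) balanced_if_potential[OF that(3)] unfolding gain_sparse_def by blast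
    then show ?thesis by linarith
  qed
  have "inj_on ?\<eta> (arcs H)"
  proof (rule inj_onI, rule ccontr)
    fix e e' assume e: "e \<in> arcs H" "e' \<in> arcs H" "?\<eta> e = ?\<eta> e'" "e \<noteq> e'"
    have ends: "tail H e' = tail H e" "head H e' = head H e" "\<psi> e' = \<psi> e"
      using e(3) by (auto simp: gain_edge_def)
    have th: "tail H e \<noteq> head H e"
      using sp[of "{e}"] e(1) by (auto simp: endpoints_def)
    have "card {e, e'} + 3 \<le> 2 * card (endpoints H {e, e'})"
      using e th by (intro bal[where \<theta> = "\<lambda>w. if w = tail H e then \<psi> e else 0"]) (auto simp: ends)
    moreover have "endpoints H {e, e'} = {tail H e, head H e}" by (auto simp: endpoints_def ends)
    ultimately show False using th e(4) by simp
  qed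
  moreover have "sparse (?\<eta> ` arcs H)"
    unfolding sparse_def
  proof (intro allI impI)
    fix F' assume "F' \<subseteq> ?\<eta> ` arcs H \<and> F' \<noteq> {}"
    then obtain F where F: "F \<subseteq> arcs H" "F' = ?\<eta> ` F" "F \<noteq> {}"
      using subset_image_iff[of F' ?\<eta> "arcs H"] by blast
    have "card F' \<le> card F" unfolding F(2) using F(1) finite_subset[OF _ finite_arcs]
      by (intro card_image_le) blast
    note le = add_le_mono1[OF this, THEN order_trans]
    show "card F' + 2 \<le> 2 * card (edge_verts F') \<and>
        ((\<exists>\<theta>. potential \<theta> F') \<longrightarrow> card F' + 3 \<le> 2 * card (edge_verts F'))"
    proof (intro conjI impI; (elim exE)?)
      show "card F' + 2 \<le> 2 * card (edge_verts F')"
        using le[OF sp[OF F(1,3)]] unfolding F(2) edge_verts_gain_edge .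
      fix \<theta> assume "potential \<theta> F'"
      then show "card F' + 3 \<le> 2 * card (edge_verts F')"
        using le[OF bal[OF F(1,3)]] unfolding F(2) edge_verts_gain_edge potential_gain_edge by blast
    qed
  qed
  ultimately show ?R ..
next
  interpret fin_digraph H by (rule assms)
  let ?\<eta> = "gain_edge H \<psi>"
  assume R: ?R
  have card: "card (?\<eta> ` F) = card F" if "F \<subseteq> arcs H" for F
    using R that by (meson card_image inj_on_subset)
  have sub: "?\<eta> ` F \<subseteq> ?\<eta> ` arcs H" "?\<eta> ` F \<noteq> {}" if "F \<subseteq> arcs H" "F \<noteq> {}" for F
    using that by auto
  show ?L unfolding gain_sparse_def
  proof (intro conjI allI impI; elim conjE)
    fix F assume F: "F \<subseteq> arcs H" "F \<noteq> {}"
    have "card (?\<eta> ` F) + 2 \<le> 2 * card (edge_verts (?\<eta> ` F))"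
      using R sub[OF F] unfolding sparse_def by blast
    then show "int (card F) \<le> int 2 * int (card (endpoints H F)) - int 2"
      unfolding card[OF F(1)] edge_verts_gain_edge by simp
  next
    fix F assume F: "F \<subseteq> arcs H" "F \<noteq> {}" "balanced H \<psi> F"
    obtain \<theta> where "\<forall>e\<in>F. \<psi> e = \<theta> (tail H e) + \<theta> (head H e)"
      using potential_if_balanced[OF wf_digraph _ F(1,3)] finite_subset[OF F(1) finite_arcs] by blast
    then have "potential \<theta> (?\<eta> ` F)" unfolding potential_gain_edge .
    then have "card (?\<eta> ` F) + 3 \<le> 2 * card (edge_verts (?\<eta> ` F))"
      using R sub[OF F(1,2)] unfolding sparse_def by blast
    then show "int (card F) \<le> int 2 * int (card (endpoints H F)) - int 3"
      unfolding card[OF F(1)] edge_verts_gain_edge by simp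
  qed
qed

context Cs_representation
begin

lemma orbit_row_eq: "orbit_row \<tau> H \<psi> p = trow p \<circ> gain_edge H \<psi>"
  by (simp add: fun_eq_iff orbit_row_eq_trow gain_edge_def)

lemma orbit_row_independent_iff:
  "orbit_row_independent \<tau> H \<psi> p \<longleftrightarrow>
    inj_on (gain_edge H \<psi>) (arcs H) \<and> row_indep (gain_edge H \<psi> ` arcs H) p"
proof -
  have "inj_on (trow p \<circ> gain_edge H \<psi>) (arcs H) \<longleftrightarrow>
      inj_on (gain_edge H \<psi>) (arcs H) \<and> inj_on (trow p) (gain_edge H \<psi> ` arcs H)"
    by (meson comp_inj_on inj_on_imageI inj_on_imageI2)
  then show ?thesis
    unfolding orbit_row_independent_def orbit_row_eq row_indep_def image_comp by blast
qed

end

section \<open>Regular placements\<close>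

lemma rigidity_row_axis:
  "rigidity_row P x y = axis x (P x - P y) - axis y (P x - P y)"
  by (simp add: rigidity_row_def axis_def vec_eq_iff)

lemma rigidity_row_sym: "rigidity_row P x y = rigidity_row P y x"
  by (simp add: rigidity_row_def vec_eq_iff)

context Cs_representation
begin

text \<open>The rows of the orbit rigidity matrix \<open>O_0\<close> of the trivial character.\<close>

definition srow :: "('v::finite \<Rightarrow> real^2) \<Rightarrow> 'v gain_edge \<Rightarrow> (real^2)^'v" where
  "srow p = (\<lambda>(u, v, g). axis u (p u - T g (p v)) - axis v (T g (p u - T g (p v))))"

lemma srow_affine: "srow (\<lambda>v. p v + t *\<^sub>R q v) e = srow p e + t *\<^sub>R srow q e"
proof -
  obtain u v g where e: "e = (u, v, g)" by (cases e)
  have d: "p u + t *\<^sub>R q u - T g (p v + t *\<^sub>R q v) = (p u - T g (p v)) + t *\<^sub>R (q u - T g (q v))"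
    by (simp add: T_linear scaleR_diff_right)
  have "axis u (x + t *\<^sub>R y) - axis v (T g (x + t *\<^sub>R y)) =
      axis u x - axis v (T g x) + t *\<^sub>R (axis u y - axis v (T g y))" for x y
    by (simp add: T_linear axis_linear scaleR_diff_right)
  then show ?thesis unfolding e srow_def split d .
qed

section \<open>Symmetric and antisymmetric vectors on the covering graph\<close>

definition sym_lift :: "(real^2)^'v::finite \<Rightarrow> (real^2)^(bit \<times> 'v)" where
  "sym_lift m = (\<chi> i. T (fst i) (m $ snd i))"

text \<open>The images of \<open>sym_lift\<close> and \<open>antisym_lift\<close> are the isotypic
  components of the trivial and of the sign character for the group action on motions of the
  covering framework.\<close>

definition antisym_lift :: "(real^2)^'v::finite \<Rightarrow> (real^2)^(bit \<times> 'v)" where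
  "antisym_lift m = (\<chi> i. S (fst i) (m $ snd i))"

lemma linear_lifts: "linear sym_lift" "linear antisym_lift"
  by (rule linearI; rule vec_eq_iff[THEN iffD2];
      simp add: sym_lift_def antisym_lift_def T_linear S_linear)+

lemma inj_lifts: "inj sym_lift" "inj antisym_lift"
proof -
  have 0: "m $ v = sym_lift m $ (0, v)" "m $ v = antisym_lift m $ (0, v)"
    for m :: "(real^2)^'v" and v :: "'v::finite"
    by (simp_all add: sym_lift_def antisym_lift_def)
  show "inj (sym_lift :: (real^2)^'v::finite \<Rightarrow> _)"
  proof (rule injI)
    fix m m' :: "(real^2)^'v" assume eq: "sym_lift m = sym_lift m'"
    show "m = m'"
      by (rule vec_eq_iff[THEN iffD2]) (use 0(1)[of m] 0(1)[of m'] eq in metis)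
  qed
  show "inj (antisym_lift :: (real^2)^'v::finite \<Rightarrow> _)"
  proof (rule injI)
    fix m m' :: "(real^2)^'v" assume eq: "antisym_lift m = antisym_lift m'"
    show "m = m'"
      by (rule vec_eq_iff[THEN iffD2]) (use 0(2)[of m] 0(2)[of m'] eq in metis)
  qed
qed

lemma UNIV_bit: "(UNIV :: bit set) = {0, 1}"
  by (auto intro: bit.exhaust)

text \<open>The maps \<open>T h\<close> are isometries, so the two layers contribute equal products
  with opposite signs.\<close>

lemma lifts_orthogonal: "sym_lift m \<bullet> antisym_lift m' = 0"
proof -
  have "sym_lift m \<bullet> antisym_lift m' = (\<Sum>(h, v)\<in>UNIV \<times> UNIV. T h (m $ v) \<bullet> S h (m' $ v))"
    by (simp add: inner_vec_def sym_lift_def antisym_lift_def split_beta)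
  also have "\<dots> = (\<Sum>h\<in>UNIV. \<Sum>v\<in>UNIV. T h (m $ v) \<bullet> S h (m' $ v))"
    by (rule sum.cartesian_product[symmetric])
  also have "\<dots> = (\<Sum>h\<in>UNIV. \<Sum>v\<in>UNIV. bit_sign h * (m $ v \<bullet> m' $ v))"
    by (simp add: S_def T_inner)
  also have "\<dots> = 0" by (simp add: UNIV_bit bit_sign_def sum_negf)
  finally show ?thesis .
qed

definition lift_row :: "('v::finite \<Rightarrow> real^2) \<Rightarrow> bit \<Rightarrow> 'v gain_edge \<Rightarrow> (real^2)^(bit \<times> 'v)" where
  "lift_row p h = (\<lambda>(u, v, g). rigidity_row (covering_placement \<tau> p) (h, u) (h + g, v))"

lemma lift_row_eq:
  "lift_row p h (u, v, g) =
    axis (h, u) (T h (p u - T g (p v))) - axis (h + g, v) (T h (p u - T g (p v)))"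
  by (simp add: lift_row_def rigidity_row_axis covering_placement_def T_def[symmetric] T_add T_linear)

lemma sym_lift_axis:
  fixes v :: "'v::finite"
  shows "sym_lift (axis v x) = axis (0, v) x + axis (1, v) (T 1 x)"
proof (rule vec_eq_iff[THEN iffD2], intro allI)
  fix i :: "bit \<times> 'v"
  obtain h w where "i = (h, w)" by (cases i)
  then show "sym_lift (axis v x) $ i = (axis (0, v) x + axis (1, v) (T 1 x)) $ i"
    by (cases "h = 0") (auto simp: sym_lift_def axis_def T_linear)
qed

lemma antisym_lift_axis:
  fixes v :: "'v::finite"
  shows "antisym_lift (axis v x) = axis (0, v) x - axis (1, v) (T 1 x)"
proof (rule vec_eq_iff[THEN iffD2], intro allI)
  fix i :: "bit \<times> 'v"
  obtain h w where "i = (h, w)" by (cases i)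
  then show "antisym_lift (axis v x) $ i = (axis (0, v) x - axis (1, v) (T 1 x)) $ i"
    by (cases "h = 0") (auto simp: antisym_lift_def axis_def S_def bit_sign_def T_linear)
qed

lemma sym_lift_srow: "sym_lift (srow p e) = lift_row p 0 e + lift_row p 1 e"
proof -
  obtain u v g where e: "e = (u, v, g)" by (cases e)
  show ?thesis
    unfolding e srow_def split lift_row_eq linear_diff[OF linear_lifts(1)] sym_lift_axis
    by (cases "g = 0") (simp_all)
qed

text \<open>The two covering edges above \<open>e\<close> have rows whose sum lifts the row of
  \<open>O_0\<close> and whose difference lifts that of \<open>O_1\<close>; this block-diagonalises
  the rigidity matrix.\<close>

lemma antisym_lift_trow: "antisym_lift (trow p e) = lift_row p 0 e - lift_row p 1 e"
proof -
  obtain u v g where e: "e = (u, v, g)" by (cases e)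
  show ?thesis
    unfolding e trow_def split lift_row_eq linear_diff[OF linear_lifts(2)] antisym_lift_axis
    by (cases "g = 0") (simp_all add: S_def bit_sign_def T_linear axis_linear)
qed

lemma span_lift_rows:
  "span (\<Union>h. lift_row p h ` E) = span (sym_lift ` srow p ` E \<union> antisym_lift ` trow p ` E)"
    (is "span ?A = span ?B")
  unfolding span_eq
proof
  show "?A \<subseteq> span ?B"
  proof clarify
    fix h u v g assume e: "(u, v, g) \<in> E"
    let ?e = "(u, v, g)"
    have 1: "sym_lift (srow p ?e) \<in> span ?B" "antisym_lift (trow p ?e) \<in> span ?B"
      using e by (auto intro!: span_base)
    have "(1/2) *\<^sub>R (sym_lift (srow p ?e) + antisym_lift (trow p ?e)) = lift_row p 0 ?e"
      "(1/2) *\<^sub>R (sym_lift (srow p ?e) - antisym_lift (trow p ?e)) = lift_row p 1 ?e"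
      unfolding sym_lift_srow antisym_lift_trow by (simp_all add: vec_eq_iff)
    then have "lift_row p 0 ?e \<in> span ?B" "lift_row p 1 ?e \<in> span ?B"
      using 1 by (metis span_add span_scale, metis span_diff span_scale)
    then show "lift_row p h ?e \<in> span ?B" by (cases "h = 0") simp_all
  qed
  show "?B \<subseteq> span ?A"
  proof (intro subsetI, elim UnE imageE)
    have base: "lift_row p h e \<in> span ?A" if "e \<in> E" for h e
      using that by (intro span_base) blast
    show "x \<in> span ?A" if "x = sym_lift y" "y = srow p e" "e \<in> E" for x y e
      unfolding that(1,2) sym_lift_srow by (intro span_add base that)
    show "x \<in> span ?A" if "x = antisym_lift y" "y = trow p e" "e \<in> E" for x y e
      unfolding that(1,2) antisym_lift_trow by (intro span_diff base that)
  qed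
qed

lemma covering_rows:
  "{rigidity_row (covering_placement \<tau> p) x y | x y. {x, y} \<in> covering_edges H \<psi>} =
    (\<Union>h. lift_row p h ` gain_edge H \<psi> ` arcs H)" (is "?A = ?B")
proof
  show "?A \<subseteq> ?B"
  proof clarify
    fix x y assume "{x, y} \<in> covering_edges H \<psi>"
    then obtain h e where he: "{x, y} = {(h, tail H e), (h + \<psi> e, head H e)}" "e \<in> arcs H"
      unfolding covering_edges_def by blast
    then have "rigidity_row (covering_placement \<tau> p) x y = lift_row p h (gain_edge H \<psi> e)"
      using rigidity_row_sym by (auto simp: doubleton_eq_iff lift_row_def gain_edge_def)
    then show "rigidity_row (covering_placement \<tau> p) x y \<in> ?B" using he(2) by blast
  qed
  show "?B \<subseteq> ?A"
  proof
    fix z assume "z \<in> ?B"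
    then obtain h e where z: "z = lift_row p h (gain_edge H \<psi> e)" "e \<in> arcs H" by blast
    then have "{(h, tail H e), (h + \<psi> e, head H e)} \<in> covering_edges H \<psi>"
      unfolding covering_edges_def by blast
    then show "z \<in> ?A" unfolding z(1) lift_row_def gain_edge_def split by blast
  qed
qed

text \<open>The lifts are injective with orthogonal images, so the dimensions of the two blocks add
  up.\<close>

lemma rigidity_rank_split:
  "rigidity_rank (covering_edges H \<psi>) (covering_placement \<tau> p) =
    dim (srow p ` gain_edge H \<psi> ` arcs H) + dim (trow p ` gain_edge H \<psi> ` arcs H)"
proof -
  let ?E = "gain_edge H \<psi> ` arcs H"
  have "rigidity_rank (covering_edges H \<psi>) (covering_placement \<tau> p) =
      dim (sym_lift ` srow p ` ?E \<union> antisym_lift ` trow p ` ?E)"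
    unfolding rigidity_rank_def covering_rows by (metis span_lift_rows dim_span)
  also have "\<dots> = dim (sym_lift ` srow p ` ?E) + dim (antisym_lift ` trow p ` ?E)"
    by (rule dim_orthogonal_sum) (auto simp: lifts_orthogonal)
  also have "dim (sym_lift ` srow p ` ?E) = dim (srow p ` ?E)"
    by (rule dim_image_eq[OF linear_lifts(1)]) (rule inj_on_subset[OF inj_lifts(1) subset_UNIV])
  also have "dim (antisym_lift ` trow p ` ?E) = dim (trow p ` ?E)"
    by (rule dim_image_eq[OF linear_lifts(2)]) (rule inj_on_subset[OF inj_lifts(2) subset_UNIV])
  finally show ?thesis .
qed

text \<open>Regularity concerns the sum of the ranks of \<open>O_0\<close> and \<open>O_1\<close>. On the line through
  \<open>p\<close> and \<open>q\<close> almost every placement has at least the rank of \<open>O_0\<close> at \<open>p\<close> and the rank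
  of \<open>O_1\<close> at \<open>q\<close>.\<close>

lemma regular_imp_row_indep:
  fixes H :: "('v::finite, 'e) pre_digraph"
  assumes reg: "regular_placement \<tau> H \<psi> p" and q: "row_indep (gain_edge H \<psi> ` arcs H) q"
  shows "row_indep (gain_edge H \<psi> ` arcs H) p"
proof -
  let ?E = "gain_edge H \<psi> ` arcs H"
  \<comment> \<open>A basis of the row space of \<open>O_0\<close> at \<open>p\<close>; its
    independence persists at almost all points of the line.\<close>
  obtain B where B: "B \<subseteq> srow p ` ?E" "independent B" "card B = dim (srow p ` ?E)"
    by (metis basis_exists)
  then obtain E0 where E0: "E0 \<subseteq> ?E" "inj_on (srow p) E0" "B = srow p ` E0"
    unfolding subset_image_inj by blast
  define d where "d v = q v - p v" for v
  define r where "r t v = p v + t *\<^sub>R d v" for t v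
  \<comment> \<open>The same line started at \<open>q\<close>, where the rows of \<open>O_1\<close>
    are independent, with parameter \<open>1 - t\<close>.\<close>
  have r': "r t = (\<lambda>v. q v + (1 - t) *\<^sub>R (p v - q v))" for t
    by (simp add: r_def d_def fun_eq_iff vec_eq_iff algebra_simps)
  let ?B0 = "{t. \<not> (inj_on (srow (r t)) E0 \<and> independent (srow (r t) ` E0))}"
  let ?B1 = "{t. \<not> row_indep ?E (\<lambda>v. q v + t *\<^sub>R (p v - q v))}"
  have "finite ?B0"
    using finite_dependent_pencil[of E0 "srow p" "srow d"] E0 B(2)
    unfolding r_def srow_affine[abs_def] by simp
  moreover have "finite ?B1" by (rule finite_not_row_indep_line[OF q])
  ultimately have fin: "finite (?B0 \<union> (\<lambda>t. 1 - t) ` ?B1)" by simp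
  obtain t where t: "t \<notin> ?B0 \<union> (\<lambda>t. 1 - t) ` ?B1"
    using ex_new_if_finite[OF infinite_UNIV_char_0 fin] by (elim exE)
  have "1 - t \<notin> ?B1"
  proof
    assume "1 - t \<in> ?B1"
    then have "1 - (1 - t) \<in> (\<lambda>t. 1 - t) ` ?B1" by (rule imageI)
    then show False using t by simp
  qed
  then have ind: "row_indep ?E (r t)" by (simp add: r')
  have "dim (srow p ` ?E) = card E0" using B(3) E0(2,3) by (simp add: card_image)
  also have "\<dots> = card (srow (r t) ` E0)" using t by (simp add: card_image)
  also have "\<dots> \<le> dim (srow (r t) ` ?E)"
    using t E0(1) by (intro independent_card_le_dim) auto
  finally have "dim (srow p ` ?E) \<le> dim (srow (r t) ` ?E)" .
  moreover have "dim (srow (r t) ` ?E) + dim (trow (r t) ` ?E) \<le> dim (srow p ` ?E) + dim (trow p ` ?E)"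
    using reg unfolding regular_placement_def rigidity_rank_split by blast
  moreover have "dim (trow (r t) ` ?E) = card ?E"
    using ind by (simp add: row_indep_def dim_eq_card_independent card_image)
  \<comment> \<open>At \<open>r t\<close> the rank of \<open>O_0\<close> is at least that at
    \<open>p\<close>. Maximality of the sum at \<open>p\<close> thus forces the rank of
    \<open>O_1\<close> there to be full.\<close>
  ultimately have le: "card ?E \<le> dim (trow p ` ?E)" by linarith
  have fE: "finite ?E" by simp
  have "dim (trow p ` ?E) \<le> card (trow p ` ?E)" by (rule dim_le_card') simp
  moreover have "card (trow p ` ?E) \<le> card ?E" by (rule card_image_le[OF fE])
  ultimately have eq: "card (trow p ` ?E) = card ?E" "card (trow p ` ?E) = dim (trow p ` ?E)"
    using le by linarith+
  have "inj_on (trow p) ?E" by (rule eq_card_imp_inj_on[OF fE eq(1)])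
  moreover have "independent (trow p ` ?E)"
    using card_eq_dim[OF subset_refl eq(2)] span_superset by simp
  ultimately show ?thesis unfolding row_indep_def by blast
qed

end

text \<open>If \<open>\<tau> 0\<close> were the reflection, \<open>\<tau> 1\<close> would be the
  identity by injectivity, and so would its square \<open>\<tau> 0\<close>.\<close>

lemma Cs_representationI:
  assumes "is_Cs C" "faithful_representation C \<tau>"
  obtains n where "Cs_representation \<tau> n"
proof -
  obtain n where n: "n \<noteq> 0" "C = {mat 1, reflection_matrix n}"
    using assms(1) unfolding is_Cs_def by blast
  have hom: "\<tau> (g + h) = \<tau> g ** \<tau> h" and C: "\<tau> g \<in> {mat 1, reflection_matrix n}" and inj: "inj \<tau>" for g h
    using assms(2) n(2) unfolding faithful_representation_def by auto
  have idem: "\<tau> 0 ** \<tau> 0 = \<tau> 0" using hom[of 0 0] by simp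
  have inv: "\<tau> 1 ** \<tau> 1 = \<tau> 0" using hom[of 1 1] by simp
  have ne: "\<tau> 0 \<noteq> \<tau> 1" using inj by (simp add: inj_eq)
  have "\<tau> 0 = mat 1"
  proof (rule ccontr)
    assume "\<tau> 0 \<noteq> mat 1"
    then have "\<tau> 1 = mat 1" using C[of 0] C[of 1] ne by auto
    then show False using inv \<open>\<tau> 0 \<noteq> mat 1\<close> by simp
  qed
  moreover from this have "\<tau> 1 = reflection_matrix n" using C[of 1] ne by auto
  ultimately show ?thesis using n(1) that by (simp add: Cs_representation_def)
qed

theorem theorem6p3:
  fixes C :: "(real^2^2) set"
    and \<tau> :: "bit \<Rightarrow> real^2^2"
    and H :: "('v::finite, 'e) pre_digraph"
    and \<psi> :: "'e \<Rightarrow> bit"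
    and p :: "'v \<Rightarrow> real^2"
  assumes "is_Cs C"
    and "faithful_representation C \<tau>"
    and "fin_digraph H"
    and "regular_placement \<tau> H \<psi> p"
  shows "orbit_row_independent \<tau> H \<psi> p \<longleftrightarrow> gain_sparse 2 3 2 H \<psi>"
proof -
  obtain n where "Cs_representation \<tau> n" using Cs_representationI[OF assms(1,2)] .
  then interpret Cs_representation \<tau> n .
  \<comment> \<open>Sparsity provides some independent placement, and regularity transfers
    independence to \<open>p\<close>.\<close>
  have "row_indep (gain_edge H \<psi> ` arcs H) p \<longleftrightarrow> sparse (gain_edge H \<psi> ` arcs H)"
    using row_indep_imp_sparse sparse_imp_row_indep regular_imp_row_indep[OF assms(4)] by blast
  then show ?thesis
    unfolding orbit_row_independent_iff gain_sparse_iff[OF assms(3)] by blast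
qed

end
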